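(* Let $\mu$ be a probability measure on $\mathbb{N}=\{0,1,2,\dots\}$ that is critical (i.e. $\sum_{k\ge 0}k\,\mu(k)=1$) and nondegenerate (i.e. $\mu(1)<1$). Let $\theta$ be a probability measure on $\mathbb{Z}^4$ with zero mean and finite fifth moment (i.e. $\sum_{x}x\,\theta(x)=0$ and $\sum_x |x|^5\theta(x)<\infty$), which is not supported on a strict subgroup of $\mathbb{Z}^4$. Let $\mathcal{S}$ be the critical branching random walk in $\mathbb{Z}^4$ started from the origin with offspring distribution $\mu$ and jump distribution $\theta$. Then there exists a positive constant $C$, depending on $\mu$ and $\theta$, such that for every $a\in\mathbb{Z}^4$ with $|a|$ sufficiently large, $$P(\mathcal{S}\text{ visits }a)\le C\cdot\frac{1}{|a|^2\log|a|}.$$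
   Context: $|\cdot|$ denotes the Euclidean norm. The branching random walk with offspring distribution $\mu$ and jump distribution $\theta$ is defined as follows. Let $T$ be a Galton–Watson tree (rooted ordered tree) with offspring distribution $\mu$ and vertex set $V(T)$. Conditionally on $T$, assign to the edges $e$ of $T$ independent random variables $Y_e$ with law $\theta$. For $v\in V(T)$, let $\mathcal{S}(v)\in\mathbb{Z}^4$ be the sum of the $Y_e$ over the edges $e$ of the unique simple path in $T$ from the root to $v$ (so the root is mapped to $0$). Equivalently: start with one particle at $0$; at each time step every particle, say at $x$, gives birth to a random number of offspring with law $\mu$ and dies, and each offspring independently moves to $x+Y$ with $Y\sim\theta$. We say that $\mathcal{S}$ visits $a$ if there is $v\in V(T)$ with $\mathcal{S}(v)=a$. *)

theory Defs
  imports "HOL-Probability.Probability" "HOL-Algebra.Group"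
begin

definition real_vec :: "int ^ 'n \<Rightarrow> real ^ 'n" where
  "real_vec x = (\<chi> i. real_of_int (x $ i))"

definition vec_group :: "(int ^ 'n) monoid" where
  "vec_group = \<lparr>carrier = UNIV, monoid.mult = (+), one = 0\<rparr>"

(* Ulam-Harris labelling of rooted ordered trees: [] is the root, and the children of v are
   v @ [0], ..., v @ [N v - 1], where N v is the number of offspring of v. *)
definition tree :: "(nat list \<Rightarrow> nat) \<Rightarrow> nat list set" where
  "tree N = {v. \<forall>k < length v. v ! k < N (take k v)}"

(* Y u is the jump along the edge joining u to its parent; take 1 v, ..., take (length v) v are
   the lower endpoints of the edges on the path from the root to v. *)
definition position :: "(nat list \<Rightarrow> int ^ 'n) \<Rightarrow> nat list \<Rightarrow> int ^ 'n" where
  "position Y v = (\<Sum>k = 1..length v. Y (take k v))"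

definition visits :: "(nat list \<Rightarrow> nat) \<times> (nat list \<Rightarrow> int ^ 'n) \<Rightarrow> int ^ 'n \<Rightarrow> bool" where
  "visits \<omega> a \<longleftrightarrow> (\<exists>v \<in> tree (fst \<omega>). position (snd \<omega>) v = a)"

(* Offspring numbers and jumps are attached to all labels, i.i.d. and independently of each other,
   although only the labels belonging to the tree are used. So tree (fst \<omega>) is a Galton-Watson
   tree with offspring law \<mu>, and given it the jumps along its edges are i.i.d. with law \<theta>. *)
definition brw :: "nat pmf \<Rightarrow> (int ^ 'n) pmf \<Rightarrow>
    ((nat list \<Rightarrow> nat) \<times> (nat list \<Rightarrow> int ^ 'n)) measure" where
  "brw \<mu> \<theta> = (\<Pi>\<^sub>M u\<in>UNIV. measure_pmf \<mu>) \<Otimes>\<^sub>M (\<Pi>\<^sub>M u\<in>UNIV. measure_pmf \<theta>)"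

lemma group_vec_group: "group (vec_group :: (int ^ 'n) monoid)"
  by (rule groupI) (auto simp: vec_group_def add.assoc intro: exI[of _ "- x" for x])

lemma subgroup_vec_group_iff:
  "subgroup H (vec_group :: (int ^ 'n) monoid) \<longleftrightarrow>
     0 \<in> H \<and> (\<forall>x\<in>H. \<forall>y\<in>H. x + y \<in> H) \<and> (\<forall>x\<in>H. - x \<in> H)"
proof -
  have "inv\<^bsub>vec_group\<^esub> x = - x" for x :: "int ^ 'n"
    by (rule group.inv_equality[OF group_vec_group]) (auto simp: vec_group_def)
  thus ?thesis
    by (auto simp: subgroup_def) (auto simp: vec_group_def)
qed

lemma prob_space_brw: "prob_space (brw \<mu> \<theta>)"
proof -
  interpret A: product_prob_space "\<lambda>_. measure_pmf \<mu>" "UNIV :: nat list set" ..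
  interpret B: product_prob_space "\<lambda>_. measure_pmf \<theta>" "UNIV :: nat list set" ..
  interpret pair_prob_space "\<Pi>\<^sub>M u\<in>(UNIV :: nat list set). measure_pmf \<mu>"
    "\<Pi>\<^sub>M u\<in>(UNIV :: nat list set). measure_pmf \<theta>" ..
  show ?thesis unfolding brw_def by (rule prob_space_axioms)
qed

lemma measurable_fst_brw: "(\<lambda>\<omega>. fst \<omega> u) \<in> brw \<mu> \<theta> \<rightarrow>\<^sub>M count_space UNIV"
proof -
  have "(\<lambda>\<omega>. fst \<omega> u) \<in> brw \<mu> \<theta> \<rightarrow>\<^sub>M measure_pmf \<mu>"
    unfolding brw_def by measurable
  thus ?thesis by (simp cong: measurable_cong_sets)
qed

lemma measurable_snd_brw: "(\<lambda>\<omega>. snd \<omega> u) \<in> brw \<mu> \<theta> \<rightarrow>\<^sub>M count_space UNIV"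
proof -
  have "(\<lambda>\<omega>. snd \<omega> u) \<in> brw \<mu> \<theta> \<rightarrow>\<^sub>M measure_pmf \<theta>"
    unfolding brw_def by measurable
  thus ?thesis by (simp cong: measurable_cong_sets)
qed

lemma measurable_visits: "Measurable.pred (brw \<mu> \<theta>) (\<lambda>\<omega>. visits \<omega> a)"
proof -
  note [measurable] = measurable_fst_brw measurable_snd_brw
  have sum: "Measurable.pred (brw \<mu> \<theta>) (\<lambda>\<omega>. (\<Sum>k\<in>K. snd \<omega> (f k)) = a)"
    if "finite K" for K :: "nat set" and f a
    using that
  proof (induction K arbitrary: a)
    case empty
    show ?case by simp
  next
    case (insert j K)
    note [measurable] = insert.IH
    have "(\<lambda>\<omega>. (\<Sum>k\<in>insert j K. snd \<omega> (f k)) = a) =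
          (\<lambda>\<omega>. \<exists>b. snd \<omega> (f j) = b \<and> (\<Sum>k\<in>K. snd \<omega> (f k)) = a - b)"
      using insert.hyps by (auto simp: fun_eq_iff algebra_simps)
    also have "Measurable.pred (brw \<mu> \<theta>) \<dots>" by measurable
    finally show ?case .
  qed
  have [measurable]: "Measurable.pred (brw \<mu> \<theta>) (\<lambda>\<omega>. position (snd \<omega>) v = a)" for v
    unfolding position_def by (rule sum) simp
  have "(\<lambda>\<omega>. visits \<omega> a) = (\<lambda>\<omega>. \<exists>v.
      (\<forall>k\<in>{..<length v}. v ! k < fst \<omega> (take k v)) \<and> position (snd \<omega>) v = a)"
    by (auto simp: visits_def tree_def fun_eq_iff)
  also have "Measurable.pred (brw \<mu> \<theta>) \<dots>" by measurable
  finally show ?thesis .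
qed

end

theory Submission
  imports Defs
begin

text \<open>
  Let \<open>p x\<close> be the probability that the walk started at \<open>x\<close> ever visits \<open>a\<close>, and let \<open>P\<close> be the
  transition operator of \<open>\<theta>\<close>. The branching property gives \<open>p x = F (P p x)\<close> for \<open>x \<noteq> a\<close>,
  where \<open>F t = 1 - E (1 - t)\<^sup>N \<le> t - b t\<^sup>2\<close> is increasing and \<open>b = \<mu> {2..} > 0\<close>. By induction on the generation,
  \<open>p \<le> w\<close> for every \<open>w\<close> with values in \<open>[0, 1]\<close>, \<open>w a = 1\<close> and \<open>F (P w x) \<le> w x\<close> for \<open>x \<noteq> a\<close>;
  no decay of \<open>p\<close> at infinity is needed.

  Let \<open>q\<close> be the quadratic form of the inverse covariance matrix of \<open>\<theta>\<close>, evaluated at \<open>x - a\<close>. In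
  dimension 4, \<open>1 / q\<close> is harmonic for the corresponding Brownian motion, and for
  \<open>\<psi> q = 1 / (q ln q)\<close> only \<open>4 \<psi>' + 2 q \<psi>'' = O(\<psi>\<^sup>2)\<close> is left over. Hence \<open>w = min 1 (C \<psi>(q))\<close>
  satisfies \<open>P w \<le> w + O(C \<psi>\<^sup>2)\<close> with a constant independent of \<open>C\<close>, and the nonlinear term
  \<open>b C\<^sup>2 \<psi>\<^sup>2\<close> absorbs the error once \<open>C\<close> is large. The fifth moment makes the error from jumps of
  size comparable to \<open>|x - a|\<close> of order \<open>q\<close> to the power \<open>- 5 / 2\<close>, which is \<open>O(\<psi>\<^sup>2)\<close>.
\<close>

section \<open>The branching property\<close>

text \<open>The configuration seen from child \<open>i\<close> of the root. The jump along the edge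
  to that child becomes the jump at the new label \<open>[]\<close>.\<close>

definition shift where
  "shift i \<omega> = (\<lambda>u. fst \<omega> (i # u), \<lambda>u. snd \<omega> (i # u))"

lemma space_brw [simp]: "space (brw \<mu> \<theta>) = UNIV"
  by (simp add: brw_def space_pair_measure space_PiM)

text \<open>Reindexing an i.i.d. family along the injection \<open>(#) i\<close> preserves its law;
  this is applied to both factors of the product.\<close>

lemma distr_shift_brw: "distr (brw \<mu> \<theta>) (brw \<mu> \<theta>) (shift i) = brw \<mu> \<theta>"
proof -
  let ?A = "\<Pi>\<^sub>M u\<in>(UNIV :: nat list set). measure_pmf \<mu>"
  let ?B = "\<Pi>\<^sub>M u\<in>(UNIV :: nat list set). measure_pmf \<theta>"
  let ?s = "\<lambda>\<omega> u. \<omega> (i # u)"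
  have A: "distr ?A ?A ?s = ?A"
    using distr_PiM_reindex[of UNIV "\<lambda>_. measure_pmf \<mu>" "(#) i" UNIV]
    by (simp add: restrict_def prob_space_measure_pmf)
  have B: "distr ?B ?B ?s = ?B"
    using distr_PiM_reindex[of UNIV "\<lambda>_. measure_pmf \<theta>" "(#) i" UNIV]
    by (simp add: restrict_def prob_space_measure_pmf)
  interpret B: product_prob_space "\<lambda>_. measure_pmf \<theta>" "UNIV :: nat list set" ..
  have mA: "?s \<in> ?A \<rightarrow>\<^sub>M ?A" and mB: "?s \<in> ?B \<rightarrow>\<^sub>M ?B"
    by (auto intro!: measurable_PiM_single' simp: space_PiM)
  have "distr ?A ?A ?s \<Otimes>\<^sub>M distr ?B ?B ?s = distr (?A \<Otimes>\<^sub>M ?B) (?A \<Otimes>\<^sub>M ?B) (\<lambda>(x, y). (?s x, ?s y))"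
    by (rule pair_measure_distr[OF mA mB]) (unfold B, rule B.sigma_finite_measure)
  moreover have "shift i = (\<lambda>(x, y). (?s x, ?s y))"
    by (auto simp: shift_def)
  ultimately show ?thesis unfolding A B brw_def by metis
qed

lemma measurable_into_brw:
  assumes "\<And>u. (\<lambda>x. fst (f x) u) \<in> M \<rightarrow>\<^sub>M count_space UNIV" "\<And>u. (\<lambda>x. snd (f x) u) \<in> M \<rightarrow>\<^sub>M count_space UNIV"
  shows "f \<in> M \<rightarrow>\<^sub>M brw \<mu> \<theta>"
proof -
  have "(\<lambda>x. (fst (f x), snd (f x))) \<in> M \<rightarrow>\<^sub>M brw \<mu> \<theta>"
    unfolding brw_def
    by (intro measurable_Pair measurable_PiM_single')
      (use assms in \<open>auto simp: space_PiM cong: measurable_cong_sets\<close>)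
  thus ?thesis by simp
qed

lemma measurable_shift [measurable]: "shift i \<in> brw \<mu> \<theta> \<rightarrow>\<^sub>M brw \<mu> \<theta>"
  by (rule measurable_into_brw) (simp_all add: shift_def measurable_fst_brw measurable_snd_brw)

section \<open>Independence of the labels and of the subtrees\<close>

lemma measure_brw_rectangle:
  assumes [simp]: "finite I" "finite J"
  shows "measure (brw \<mu> \<theta>) {\<omega>. (\<forall>u\<in>I. fst \<omega> u \<in> S u) \<and> (\<forall>u\<in>J. snd \<omega> u \<in> T u)} =
    (\<Prod>u\<in>I. measure \<mu> (S u)) * (\<Prod>u\<in>J. measure \<theta> (T u))"
proof -
  interpret prob_space "brw \<mu> \<theta>" by (rule prob_space_brw)
  interpret A: product_prob_space "\<lambda>_. measure_pmf \<mu>" "UNIV :: nat list set" ..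
  interpret B: product_prob_space "\<lambda>_. measure_pmf \<theta>" "UNIV :: nat list set" ..
  let ?E = "{x \<in> space (\<Pi>\<^sub>M u\<in>UNIV. measure_pmf \<mu>). \<forall>u\<in>I. x u \<in> S u}"
  let ?F = "{x \<in> space (\<Pi>\<^sub>M u\<in>UNIV. measure_pmf \<theta>). \<forall>u\<in>J. x u \<in> T u}"
  have "{\<omega>. (\<forall>u\<in>I. fst \<omega> u \<in> S u) \<and> (\<forall>u\<in>J. snd \<omega> u \<in> T u)} = ?E \<times> ?F"
    by (auto simp: space_PiM)
  moreover have "?E \<in> sets (\<Pi>\<^sub>M u\<in>UNIV. measure_pmf \<mu>)"
    by (intro sets.sets_Collect_finite_All sets_Collect_single') auto
  moreover have "?F \<in> sets (\<Pi>\<^sub>M u\<in>UNIV. measure_pmf \<theta>)"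
    by (intro sets.sets_Collect_finite_All sets_Collect_single') auto
  ultimately have "emeasure (brw \<mu> \<theta>) {\<omega>. (\<forall>u\<in>I. fst \<omega> u \<in> S u) \<and> (\<forall>u\<in>J. snd \<omega> u \<in> T u)} =
      emeasure (\<Pi>\<^sub>M u\<in>UNIV. measure_pmf \<mu>) ?E * emeasure (\<Pi>\<^sub>M u\<in>UNIV. measure_pmf \<theta>) ?F"
    unfolding brw_def by (simp add: B.emeasure_pair_measure_Times)
  also have "\<dots> = (\<Prod>u\<in>I. emeasure \<mu> (S u)) * (\<Prod>u\<in>J. emeasure \<theta> (T u))"
    by (intro arg_cong2[of _ _ _ _ "(*)"] A.emeasure_PiM_Collect B.emeasure_PiM_Collect) simp_all
  finally show ?thesis
    by (simp add: emeasure_eq_measure measure_pmf.emeasure_eq_measure prod_ennreal prod_nonneg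
        flip: ennreal_mult)
qed

text \<open>Offspring numbers and jumps are merged into one family indexed by a sum type, so that it
  can be cut into blocks containing labels of both kinds.\<close>

lemma indep_vars_labels:
  "prob_space.indep_vars (brw \<mu> \<theta>) (\<lambda>_. count_space UNIV)
     (case_sum (\<lambda>u \<omega>. Inl (fst \<omega> u)) (\<lambda>u \<omega>. Inr (snd \<omega> u))) UNIV"
    (is "prob_space.indep_vars _ _ ?Z _")
proof -
  interpret prob_space "brw \<mu> \<theta>" by (rule prob_space_brw)
  show ?thesis
    unfolding indep_vars_def2
  proof (intro conjI ballI)
    show rv: "random_variable (count_space UNIV) (?Z k)" for k
    proof (cases k)
      case (Inl u)
      show ?thesis unfolding Inl sum.case
        by (rule measurable_compose[OF measurable_fst_brw]) simp
    next
      case (Inr u)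
      show ?thesis unfolding Inr sum.case
        by (rule measurable_compose[OF measurable_snd_brw]) simp
    qed
    show "indep_sets (\<lambda>k. {?Z k -` A \<inter> space (brw \<mu> \<theta>) |A. A \<in> sets (count_space UNIV)}) UNIV"
    proof (rule indep_setsI)
      show "{?Z k -` A \<inter> space (brw \<mu> \<theta>) |A. A \<in> sets (count_space UNIV)} \<subseteq> events" for k
        using measurable_sets[OF rv] by blast
    next
      fix A :: "nat list + nat list \<Rightarrow> ((nat list \<Rightarrow> nat) \<times> (nat list \<Rightarrow> int ^ 'a)) set" and J
      assume "J \<noteq> {}" "finite J"
        and A: "\<forall>j\<in>J. A j \<in> {?Z j -` A \<inter> space (brw \<mu> \<theta>) |A. A \<in> sets (count_space UNIV)}"
      have "\<exists>B. \<forall>j\<in>J. A j = ?Z j -` B j" using A by (intro bchoice) simp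
      then obtain B where B: "\<And>j. j \<in> J \<Longrightarrow> A j = ?Z j -` B j" by blast
      define I1 I2 where "I1 = Inl -` J" and "I2 = Inr -` J"
      have fin: "finite I1" "finite I2"
        unfolding I1_def I2_def using \<open>finite J\<close> by (auto intro!: finite_vimageI)
      have J: "J = Inl ` I1 \<union> Inr ` I2"
        unfolding set_eq_iff
      proof
        fix j show "j \<in> J \<longleftrightarrow> j \<in> Inl ` I1 \<union> Inr ` I2"
          by (cases j) (auto simp: I1_def I2_def)
      qed
      have 1: "prob (A (Inl u)) = measure \<mu> (Inl -` B (Inl u))" if "u \<in> I1" for u
      proof -
        from B[of "Inl u"] that have "A (Inl u) = {\<omega>. (\<forall>u'\<in>{u}. fst \<omega> u' \<in> Inl -` B (Inl u)) \<and> (\<forall>u'\<in>{}. snd \<omega> u' \<in> UNIV)}"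
          by (auto simp: I1_def)
        show ?thesis
          using measure_brw_rectangle[where I="{u}" and J="{}" and S="\<lambda>_. Inl -` B (Inl u)" and T="\<lambda>_. UNIV"] unfolding \<open>A (Inl u) = _\<close> by simp
      qed
      have 2: "prob (A (Inr u)) = measure \<theta> (Inr -` B (Inr u))" if "u \<in> I2" for u
      proof -
        from B[of "Inr u"] that have "A (Inr u) = {\<omega>. (\<forall>u'\<in>{}. fst \<omega> u' \<in> UNIV) \<and> (\<forall>u'\<in>{u}. snd \<omega> u' \<in> Inr -` B (Inr u))}"
          by (auto simp: I2_def)
        show ?thesis
          using measure_brw_rectangle[where I="{}" and J="{u}" and S="\<lambda>_. UNIV" and T="\<lambda>_. Inr -` B (Inr u)"] unfolding \<open>A (Inr u) = _\<close> by simp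
      qed
      have "(\<Inter>j\<in>J. A j) = (\<Inter>j\<in>J. ?Z j -` B j)"
        using B by simp
      also have "\<dots> = {\<omega>. (\<forall>u\<in>I1. fst \<omega> u \<in> Inl -` B (Inl u)) \<and> (\<forall>u\<in>I2. snd \<omega> u \<in> Inr -` B (Inr u))}"
        unfolding J by (simp add: set_eq_iff ball_Un)
      finally have "prob (\<Inter>j\<in>J. A j) =
          (\<Prod>u\<in>I1. measure \<mu> (Inl -` B (Inl u))) * (\<Prod>u\<in>I2. measure \<theta> (Inr -` B (Inr u)))"
        by (simp only: measure_brw_rectangle[OF fin])
      also have "\<dots> = (\<Prod>u\<in>I1. prob (A (Inl u))) * (\<Prod>u\<in>I2. prob (A (Inr u)))"
        using 1 2 by simp
      also have "\<dots> = (\<Prod>j\<in>J. prob (A j))"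
        unfolding J using fin by (subst prod.union_disjoint) (auto simp: prod.reindex)
      finally show "prob (\<Inter>j\<in>J. A j) = (\<Prod>j\<in>J. prob (A j))" .
    qed
  qed
qed

text \<open>The root labels and the labels below each child form disjoint blocks of an independent
  family, so the events factorise. Each child contributes the same factor by
  \<open>distr_shift_brw\<close>.\<close>

lemma branching_property:
  assumes \<Phi> [measurable]: "Measurable.pred (brw \<mu> \<theta>) \<Phi>"
  shows "measure (brw \<mu> \<theta>) {\<omega>. fst \<omega> [] = n \<and> snd \<omega> [] = y \<and> (\<forall>i<n. \<Phi> (shift i \<omega>))} =
    pmf \<mu> n * pmf \<theta> y * measure (brw \<mu> \<theta>) {\<omega>. \<Phi> \<omega>} ^ n"
proof -
  interpret prob_space "brw \<mu> \<theta>" by (rule prob_space_brw)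
  let ?Z = "case_sum (\<lambda>u \<omega>. Inl (fst \<omega> u)) (\<lambda>u \<omega>. Inr (snd \<omega> u)) ::
    nat list + nat list \<Rightarrow> (nat list \<Rightarrow> nat) \<times> (nat list \<Rightarrow> int ^ 'a) \<Rightarrow> nat + int ^ 'a"
  \<comment> \<open>\<open>None\<close> is the block of the root, \<open>Some i\<close> the block
    below child \<open>i\<close>.\<close>
  define K :: "nat option \<Rightarrow> (nat list + nat list) set"
    where "K = case_option {Inl [], Inr []} (\<lambda>i. Inl ` range ((#) i) \<union> Inr ` range ((#) i))"
  \<comment> \<open>\<open>D i\<close> rebuilds \<open>shift i \<omega>\<close> from its block
    alone, so that the event at child \<open>i\<close> is a function of that block.\<close>
  define D :: "nat \<Rightarrow> (nat list + nat list \<Rightarrow> nat + int ^ 'a) \<Rightarrow> (nat list \<Rightarrow> nat) \<times> (nat list \<Rightarrow> int ^ 'a)"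
    where "D = (\<lambda>i h. (\<lambda>u. projl (h (Inl (i # u))), \<lambda>u. projr (h (Inr (i # u)))))"
  define W where
    "W = case_option (\<lambda>h. h (Inl []) = Inl n \<and> h (Inr []) = Inr y) (\<lambda>i h. \<Phi> (D i h))"
  define X where "X = (\<lambda>j \<omega>. W j (restrict (\<lambda>k. ?Z k \<omega>) (K j)))"
  have "indep_vars (\<lambda>j. PiM (K j) (\<lambda>_. count_space UNIV)) (\<lambda>j \<omega>. restrict (\<lambda>k. ?Z k \<omega>) (K j)) UNIV"
    by (rule indep_vars_restrict[OF indep_vars_labels])
      (auto simp: disjoint_family_on_def K_def split: option.splits)
  then have ind: "indep_vars (\<lambda>_. count_space UNIV) X UNIV"
    unfolding X_def
  proof (rule indep_vars_compose2)
    fix j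
    show "W j \<in> PiM (K j) (\<lambda>_. count_space UNIV) \<rightarrow>\<^sub>M count_space UNIV"
    proof (cases j)
      case None
      have [measurable]: "(\<lambda>h. h (Inl [])) \<in> PiM (K j) (\<lambda>_. count_space UNIV) \<rightarrow>\<^sub>M count_space UNIV"
        "(\<lambda>h. h (Inr [])) \<in> PiM (K j) (\<lambda>_. count_space UNIV) \<rightarrow>\<^sub>M count_space UNIV"
        by (rule measurable_component_singleton; simp add: K_def None)+
      show ?thesis unfolding W_def None option.case unfolding None[symmetric] by measurable
    next
      case (Some i)
      have "D i \<in> PiM (K j) (\<lambda>_. count_space UNIV) \<rightarrow>\<^sub>M brw \<mu> \<theta>"
      proof (rule measurable_into_brw)
        fix u
        show "(\<lambda>h. fst (D i h) u) \<in> PiM (K j) (\<lambda>_. count_space UNIV) \<rightarrow>\<^sub>M count_space UNIV"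
          unfolding D_def fst_conv
          by (rule measurable_compose[OF measurable_component_singleton[where i="Inl (i # u)"]])
            (simp_all add: K_def Some)
        show "(\<lambda>h. snd (D i h) u) \<in> PiM (K j) (\<lambda>_. count_space UNIV) \<rightarrow>\<^sub>M count_space UNIV"
          unfolding D_def snd_conv
          by (rule measurable_compose[OF measurable_component_singleton[where i="Inr (i # u)"]])
            (simp_all add: K_def Some)
      qed
      from measurable_compose[OF this \<Phi>] show ?thesis by (simp add: W_def Some)
    qed
  qed
  have X_None: "X None \<omega> \<longleftrightarrow> fst \<omega> [] = n \<and> snd \<omega> [] = y" for \<omega>
    by (simp add: X_def W_def K_def)
  have X_Some: "X (Some i) \<omega> \<longleftrightarrow> \<Phi> (shift i \<omega>)" for i \<omega>
    by (simp add: X_def W_def K_def D_def shift_def image_iff)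
  have prob_Some: "prob (X (Some i) -` {True}) = prob {\<omega>. \<Phi> \<omega>}" for i
  proof -
    have "prob {\<omega>. \<Phi> \<omega>} = measure (distr (brw \<mu> \<theta>) (brw \<mu> \<theta>) (shift i)) {\<omega>. \<Phi> \<omega>}"
      by (simp add: distr_shift_brw)
    also have "\<dots> = prob (shift i -` {\<omega>. \<Phi> \<omega>} \<inter> space (brw \<mu> \<theta>))"
      using predE[OF \<Phi>] by (intro measure_distr) auto
    also have "shift i -` {\<omega>. \<Phi> \<omega>} \<inter> space (brw \<mu> \<theta>) = X (Some i) -` {True}"
      by (simp add: set_eq_iff X_Some)
    finally show ?thesis by simp
  qed
  let ?J = "insert None (Some ` {..<n})"
  have indep: "prob (\<Inter>j\<in>?J. X j -` {True} \<inter> space (brw \<mu> \<theta>)) =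
      (\<Prod>j\<in>?J. prob (X j -` {True} \<inter> space (brw \<mu> \<theta>)))"
    by (rule indep_varsD[OF ind]) auto
  have event: "(\<Inter>j\<in>?J. X j -` {True} \<inter> space (brw \<mu> \<theta>)) =
      {\<omega>. fst \<omega> [] = n \<and> snd \<omega> [] = y \<and> (\<forall>i<n. \<Phi> (shift i \<omega>))}"
    by (simp add: set_eq_iff X_None X_Some, simp add: Ball_def)
  have factors: "(\<Prod>j\<in>?J. prob (X j -` {True} \<inter> space (brw \<mu> \<theta>))) =
      prob (X None -` {True}) * prob {\<omega>. \<Phi> \<omega>} ^ n"
    by (simp add: prod.reindex prob_Some)
  have "prob (X None -` {True}) = pmf \<mu> n * pmf \<theta> y"
  proof -
    have "X None -` {True} = {\<omega>. (\<forall>u\<in>{[]}. fst \<omega> u \<in> {n}) \<and> (\<forall>u\<in>{[]}. snd \<omega> u \<in> {y})}"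
      by (simp add: set_eq_iff X_None)
    then show ?thesis
      by (simp only: measure_brw_rectangle finite.intros) (simp add: pmf.rep_eq)
  qed
  with indep show ?thesis unfolding event factors by (simp only:)
qed

section \<open>The walk up to a finite generation\<close>

lemma position_Nil [simp]: "position Y [] = 0"
  by (simp add: position_def)

lemma position_Cons: "position Y (i # v) = Y [i] + position (\<lambda>u. Y (i # u)) v"
proof -
  have "position Y (i # v) = (\<Sum>k = Suc 0..Suc (length v). Y (take k (i # v)))"
    by (simp add: position_def)
  also have "\<dots> = (\<Sum>k = 0..length v. Y (i # take k v))"
    by (subst sum.shift_bounds_cl_Suc_ivl) simp
  also have "\<dots> = Y [i] + position (\<lambda>u. Y (i # u)) v"
    by (simp add: position_def sum.atLeast_Suc_atMost)
  finally show ?thesis .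
qed

lemma tree_Nil [simp]: "[] \<in> tree N"
  by (simp add: tree_def)

lemma tree_Cons [simp]: "i # v \<in> tree N \<longleftrightarrow> i < N [] \<and> v \<in> tree (\<lambda>u. N (i # u))"
  by (simp add: tree_def All_less_Suc2)

text \<open>The root label also carries a jump, which \<^const>\<open>position\<close> ignores. Counting it here
  makes the walks started from the children of the root copies of the whole configuration.\<close>

primrec hits :: "int ^ 'n \<Rightarrow> nat \<Rightarrow> (nat list \<Rightarrow> nat) \<times> (nat list \<Rightarrow> int ^ 'n) \<Rightarrow> int ^ 'n \<Rightarrow> bool" where
  "hits a 0 \<omega> x \<longleftrightarrow> x + snd \<omega> [] = a"
| "hits a (Suc m) \<omega> x \<longleftrightarrow>
    x + snd \<omega> [] = a \<or> (\<exists>i<fst \<omega> []. hits a m (shift i \<omega>) (x + snd \<omega> []))"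

text \<open>Turns the recursion, suited to induction, into a statement about vertices of bounded
  depth, from which monotonicity in \<open>m\<close> is evident.\<close>

lemma hits_iff:
  "hits a m \<omega> x \<longleftrightarrow>
    (\<exists>v\<in>tree (fst \<omega>). length v \<le> m \<and> x + snd \<omega> [] + position (snd \<omega>) v = a)"
proof (induction m arbitrary: \<omega> x)
  case 0
  show ?case by auto
next
  case (Suc m)
  have split: "(\<exists>v\<in>tree (fst \<omega>). P v) \<longleftrightarrow>
      P [] \<or> (\<exists>i<fst \<omega> []. \<exists>v\<in>tree (fst (shift i \<omega>)). P (i # v))" for P
  proof
    assume "\<exists>v\<in>tree (fst \<omega>). P v"
    then obtain v where "v \<in> tree (fst \<omega>)" "P v" by blast
    then show "P [] \<or> (\<exists>i<fst \<omega> []. \<exists>v\<in>tree (fst (shift i \<omega>)). P (i # v))"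
      by (cases v) (auto simp: shift_def)
  next
    assume "P [] \<or> (\<exists>i<fst \<omega> []. \<exists>v\<in>tree (fst (shift i \<omega>)). P (i # v))"
    then show "\<exists>v\<in>tree (fst \<omega>). P v"
      by (auto simp: shift_def intro: bexI[of _ "[]"] bexI[of _ "_ # _"])
  qed
  show ?case
    unfolding split hits.simps Suc.IH by (simp add: position_Cons shift_def add.assoc)
qed

text \<open>The walk itself makes no jump at the root, so \<open>hits\<close> applies only from the
  children on; the root accounts for \<open>a = 0\<close>.\<close>

lemma visits_iff: "visits \<omega> a \<longleftrightarrow> a = 0 \<or> (\<exists>m. \<exists>i<fst \<omega> []. hits a m (shift i \<omega>) 0)"
proof
  assume "visits \<omega> a"
  then obtain v where v: "v \<in> tree (fst \<omega>)" "position (snd \<omega>) v = a"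
    by (auto simp: visits_def)
  show "a = 0 \<or> (\<exists>m. \<exists>i<fst \<omega> []. hits a m (shift i \<omega>) 0)"
  proof (cases v)
    case Nil
    with v show ?thesis by simp
  next
    case (Cons i u)
    with v have "i < fst \<omega> []" "hits a (length u) (shift i \<omega>) 0"
      by (auto simp: hits_iff shift_def position_Cons)
    then show ?thesis by blast
  qed
next
  assume "a = 0 \<or> (\<exists>m. \<exists>i<fst \<omega> []. hits a m (shift i \<omega>) 0)"
  then show "visits \<omega> a"
  proof (elim disjE exE conjE)
    assume "a = 0"
    then show ?thesis by (auto simp: visits_def intro: bexI[of _ "[]"])
  next
    fix m i assume "i < fst \<omega> []" "hits a m (shift i \<omega>) 0"
    then obtain v where "i # v \<in> tree (fst \<omega>)" "position (snd \<omega>) (i # v) = a"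
      by (auto simp: hits_iff shift_def position_Cons)
    then show ?thesis unfolding visits_def by blast
  qed
qed

lemma measurable_hits [measurable]: "Measurable.pred (brw \<mu> \<theta>) (\<lambda>\<omega>. hits a m \<omega> x)"
proof (induction m arbitrary: x)
  case 0
  note [measurable] = measurable_snd_brw
  have "Measurable.pred (brw \<mu> \<theta>) (\<lambda>\<omega>. snd \<omega> [] = a - x)" by measurable
  then show ?case by (simp add: algebra_simps)
next
  case (Suc m)
  note [measurable] = measurable_fst_brw measurable_snd_brw Suc.IH
  have "(\<lambda>\<omega>. hits a (Suc m) \<omega> x) = (\<lambda>\<omega>. \<exists>y. snd \<omega> [] = y \<and>
      (x + y = a \<or> (\<exists>i. i < fst \<omega> [] \<and> hits a m (shift i \<omega>) (x + y))))"
    by auto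
  also have "Measurable.pred (brw \<mu> \<theta>) \<dots>" by measurable
  finally show ?case .
qed

text \<open>Sums \<open>branching_property\<close> over the countably many values of the root
  labels. \<open>\<Phi>\<close> depends on \<open>y\<close> because the children start where the
  root jump leads.\<close>

lemma emeasure_brw_children:
  fixes \<theta> :: "(int ^ 'n) pmf"
  assumes [measurable]: "\<And>y. Measurable.pred (brw \<mu> \<theta>) (\<Phi> y)"
  shows "emeasure (brw \<mu> \<theta>) {\<omega>. snd \<omega> [] \<in> S \<and> (\<forall>i<fst \<omega> []. \<Phi> (snd \<omega> []) (shift i \<omega>))} =
    (\<integral>\<^sup>+y. indicator S y * (\<integral>\<^sup>+n. ennreal (measure (brw \<mu> \<theta>) {\<omega>. \<Phi> y \<omega>} ^ n) \<partial>\<mu>) \<partial>\<theta>)"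
proof -
  interpret prob_space "brw \<mu> \<theta>" by (rule prob_space_brw)
  note [measurable] = measurable_fst_brw measurable_snd_brw
  define X where "X = (\<lambda>(y, n). {\<omega>. fst \<omega> [] = n \<and> snd \<omega> [] = y \<and> y \<in> S \<and> (\<forall>i<n. \<Phi> y (shift i \<omega>))})"
  have meas: "X p \<in> sets (brw \<mu> \<theta>)" for p
  proof -
    obtain y n where p: "p = (y, n)" by (cases p)
    have "Measurable.pred (brw \<mu> \<theta>)
        (\<lambda>\<omega>. fst \<omega> [] = n \<and> snd \<omega> [] = y \<and> y \<in> S \<and> (\<forall>i\<in>{..<n}. \<Phi> y (shift i \<omega>)))"
      by measurable
    from predE[OF this] show ?thesis by (simp add: p X_def lessThan_def)
  qed
  have "{\<omega>. snd \<omega> [] \<in> S \<and> (\<forall>i<fst \<omega> []. \<Phi> (snd \<omega> []) (shift i \<omega>))} = (\<Union>p. X p)"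
    by (auto simp: X_def)
  also have "emeasure (brw \<mu> \<theta>) \<dots> = (\<integral>\<^sup>+p. emeasure (brw \<mu> \<theta>) (X p) \<partial>count_space UNIV)"
    by (rule emeasure_UN_countable) (auto simp: meas, auto simp: X_def disjoint_family_on_def)
  also have "\<dots> = (\<integral>\<^sup>+p. ennreal (pmf (pair_pmf \<theta> \<mu>) p) *
      (indicator S (fst p) * ennreal (prob {\<omega>. \<Phi> (fst p) \<omega>} ^ snd p)) \<partial>count_space UNIV)"
  proof (intro nn_integral_cong)
    fix p :: "(int ^ 'n) \<times> nat"
    obtain y n where p: "p = (y, n)" by (cases p)
    show "emeasure (brw \<mu> \<theta>) (X p) = ennreal (pmf (pair_pmf \<theta> \<mu>) p) *
      (indicator S (fst p) * ennreal (prob {\<omega>. \<Phi> (fst p) \<omega>} ^ snd p))"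
    proof (cases "y \<in> S")
      case True
      then have "X p = {\<omega>. fst \<omega> [] = n \<and> snd \<omega> [] = y \<and> (\<forall>i<n. \<Phi> y (shift i \<omega>))}"
        by (simp add: X_def p)
      then have "emeasure (brw \<mu> \<theta>) (X p) = ennreal (pmf \<mu> n * pmf \<theta> y * prob {\<omega>. \<Phi> y \<omega>} ^ n)"
        using branching_property[OF assms[of y], where n=n and y=y] by (simp add: emeasure_eq_measure)
      with True show ?thesis
        by (simp add: p pmf_pair mult_ac flip: ennreal_mult)
    next
      case False
      then have "X p = {}" by (simp add: X_def p)
      with False show ?thesis by (simp add: p)
    qed
  qed
  also have "\<dots> = (\<integral>\<^sup>+p. (indicator S (fst p) * ennreal (prob {\<omega>. \<Phi> (fst p) \<omega>} ^ snd p)) \<partial>pair_pmf \<theta> \<mu>)"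
    by (rule nn_integral_measure_pmf[symmetric])
  also have "\<dots> = (\<integral>\<^sup>+y. \<integral>\<^sup>+n. (indicator S y * ennreal (prob {\<omega>. \<Phi> y \<omega>} ^ n)) \<partial>\<mu> \<partial>\<theta>)"
    by (simp add: nn_integral_pair_pmf')
  also have "\<dots> = (\<integral>\<^sup>+y. indicator S y * (\<integral>\<^sup>+n. ennreal (prob {\<omega>. \<Phi> y \<omega>} ^ n) \<partial>\<mu>) \<partial>\<theta>)"
    by (intro nn_integral_cong nn_integral_cmult) simp
  finally show ?thesis .
qed

section \<open>Supersolutions bound the visiting probability\<close>

lemma integrable_pmf_bounded:
  fixes f :: "'a \<Rightarrow> real"
  assumes "\<And>x. \<bar>f x\<bar> \<le> B"
  shows "integrable (measure_pmf p) f"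
  using assms by (intro measure_pmf.integrable_const_bound[of _ B]) auto

text \<open>The last assumption is \<open>F (P w x) \<le> w x\<close> in complementary form:
  \<open>1 - w\<close> is meant as a lower bound for probabilities of avoiding
  \<open>a\<close>.\<close>

locale supersolution =
  fixes \<mu> :: "nat pmf" and \<theta> :: "(int ^ 'n) pmf" and a :: "int ^ 'n" and w :: "int ^ 'n \<Rightarrow> real"
  assumes nonneg: "0 \<le> w x" and le_1: "w x \<le> 1" and target: "w a = 1"
    and step: "x \<noteq> a \<Longrightarrow> 1 - w x \<le> (\<integral>n. (1 - (\<integral>y. w (x + y) \<partial>\<theta>)) ^ n \<partial>\<mu>)"
begin

definition Pw where "Pw x = (\<integral>y. w (x + y) \<partial>\<theta>)"

lemma integrable_w: "integrable (measure_pmf \<theta>) (\<lambda>y. w (x + y))"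
  using nonneg le_1 by (intro integrable_pmf_bounded[of _ 1]) (simp add: abs_le_iff add_increasing2)

lemma Pw_nonneg: "0 \<le> Pw x"
  unfolding Pw_def by (intro integral_nonneg_AE) (simp add: nonneg)

lemma Pw_le_1: "Pw x \<le> 1"
proof -
  have "Pw x \<le> (\<integral>y. 1 \<partial>\<theta>)"
    unfolding Pw_def by (intro integral_mono integrable_w) (simp_all add: le_1)
  then show ?thesis by simp
qed

text \<open>Joins the cases \<open>x = a\<close> and \<open>x \<noteq> a\<close> in the shape of the
  integrand of \<open>emeasure_brw_children\<close>. Here \<open>p x\<close> stands for the
  probability that a child born at \<open>x\<close> and its descendants avoid
  \<open>a\<close>.\<close>

lemma target_or_step:
  assumes "\<And>x. 1 - Pw x \<le> p x"
  shows "ennreal (1 - w x) \<le> indicator (- {a}) x * (\<integral>\<^sup>+n. ennreal (p x ^ n) \<partial>\<mu>)"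
proof (cases "x = a")
  case True
  then show ?thesis by (simp add: target)
next
  case False
  have "ennreal (1 - w x) \<le> ennreal (\<integral>n. (1 - Pw x) ^ n \<partial>\<mu>)"
    using step[OF False] by (intro ennreal_leI) (simp add: Pw_def)
  also have "\<dots> = (\<integral>\<^sup>+n. ennreal ((1 - Pw x) ^ n) \<partial>\<mu>)"
    using Pw_nonneg[of x] Pw_le_1[of x]
    by (intro nn_integral_eq_integral[symmetric] integrable_pmf_bounded[of _ 1])
      (auto simp: power_le_one)
  also have "\<dots> \<le> (\<integral>\<^sup>+n. ennreal (p x ^ n) \<partial>\<mu>)"
    using Pw_le_1[of x] assms[of x] by (intro nn_integral_mono ennreal_leI power_mono) auto
  finally show ?thesis using False by simp
qed

text \<open>The comparison principle, by induction on the number of generations. The bound is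
  \<open>Pw x\<close> and not \<open>w x\<close> because \<open>hits\<close> performs the root jump
  first.\<close>

lemma prob_not_hits_ge: "1 - Pw x \<le> measure (brw \<mu> \<theta>) {\<omega>. \<not> hits a m \<omega> x}"
proof (induction m arbitrary: x)
  case 0
  have "{\<omega>. \<not> hits a 0 \<omega> x} =
      {\<omega>. (\<forall>u\<in>{}. fst \<omega> u \<in> UNIV) \<and> (\<forall>u\<in>{[]}. snd \<omega> u \<in> {y. x + y \<noteq> a})}"
    by simp
  then have "measure (brw \<mu> \<theta>) {\<omega>. \<not> hits a 0 \<omega> x} = measure \<theta> {y. x + y \<noteq> a}"
    by (simp only: measure_brw_rectangle finite.intros) simp
  also have "\<dots> = (\<integral>y. indicator {y. x + y \<noteq> a} y \<partial>\<theta>)"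
    by simp
  \<comment> \<open>The normalisation \<open>w a = 1\<close> makes \<open>1 - w\<close> vanish at
    the target, which starts the induction.\<close>
  also have "\<dots> \<ge> (\<integral>y. 1 - w (x + y) \<partial>\<theta>)"
  proof (intro integral_mono)
    show "1 - w (x + y) \<le> indicator {y. x + y \<noteq> a} y" for y
      using nonneg[of "x + y"] by (auto simp: target indicator_def)
  qed (auto intro: integrable_w integrable_pmf_bounded[of _ 1])
  also have "(\<integral>y. 1 - w (x + y) \<partial>\<theta>) = 1 - Pw x"
    using integrable_w by (simp add: Pw_def)
  finally show ?case .
next
  case (Suc m)
  interpret prob_space "brw \<mu> \<theta>" by (rule prob_space_brw)
  have "ennreal (1 - Pw x) = ennreal (\<integral>y. 1 - w (x + y) \<partial>\<theta>)"
    using integrable_w by (simp add: Pw_def)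
  also have "\<dots> = (\<integral>\<^sup>+y. ennreal (1 - w (x + y)) \<partial>\<theta>)"
    using integrable_w le_1 by (intro nn_integral_eq_integral[symmetric]) auto
  also have "\<dots> \<le> (\<integral>\<^sup>+y. indicator (- {a}) (x + y) *
      (\<integral>\<^sup>+n. ennreal (prob {\<omega>. \<not> hits a m \<omega> (x + y)} ^ n) \<partial>\<mu>) \<partial>\<theta>)"
    by (intro nn_integral_mono target_or_step Suc.IH)
  also have "\<dots> = (\<integral>\<^sup>+y. indicator {y. x + y \<noteq> a} y *
      (\<integral>\<^sup>+n. ennreal (prob {\<omega>. \<not> hits a m \<omega> (x + y)} ^ n) \<partial>\<mu>) \<partial>\<theta>)"
    by (simp add: indicator_def)
  also have "\<dots> = emeasure (brw \<mu> \<theta>) {\<omega>. snd \<omega> [] \<in> {y. x + y \<noteq> a} \<and>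
      (\<forall>i<fst \<omega> []. \<not> hits a m (shift i \<omega>) (x + snd \<omega> []))}"
    by (rule emeasure_brw_children[symmetric]) measurable
  also have "{\<omega>. snd \<omega> [] \<in> {y. x + y \<noteq> a} \<and>
      (\<forall>i<fst \<omega> []. \<not> hits a m (shift i \<omega>) (x + snd \<omega> []))} = {\<omega>. \<not> hits a (Suc m) \<omega> x}"
    by auto
  finally show ?case by (simp add: emeasure_eq_measure)
qed

text \<open>One further branching step without a jump at the root turns the bound \<open>Pw\<close>
  for the children into the bound \<open>w 0\<close>; then the number of generations tends to
  infinity.\<close>

lemma prob_visits_le: "\<P>(\<omega> in brw \<mu> \<theta>. visits \<omega> a) \<le> w 0"
proof (cases "a = 0")
  case True
  then show ?thesis using prob_space.prob_le_1[OF prob_space_brw] target by simp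
next
  case False
  interpret prob_space "brw \<mu> \<theta>" by (rule prob_space_brw)
  note [measurable] = measurable_fst_brw
  define B where "B m = {\<omega>. \<exists>i<fst \<omega> []. hits a m (shift i \<omega>) 0}" for m
  have meas: "B m \<in> events" for m
  proof -
    have "Measurable.pred (brw \<mu> \<theta>) (\<lambda>\<omega>. \<exists>i. i < fst \<omega> [] \<and> hits a m (shift i \<omega>) 0)"
      by measurable
    from predE[OF this] show ?thesis by (simp add: B_def)
  qed
  have B_le: "prob (B m) \<le> w 0" for m
  proof -
    have "ennreal (1 - w 0) \<le> indicator (- {a}) 0 *
        (\<integral>\<^sup>+n. ennreal (prob {\<omega>. \<not> hits a m \<omega> 0} ^ n) \<partial>\<mu>)"
      by (rule target_or_step[OF prob_not_hits_ge])
    \<comment> \<open>The integrand is constant in \<open>y\<close>; averaging over the root jump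
      only brings it into the form of \<open>emeasure_brw_children\<close>.\<close>
    also have "\<dots> = (\<integral>\<^sup>+y. indicator UNIV y *
        (\<integral>\<^sup>+n. ennreal (prob {\<omega>. \<not> hits a m \<omega> 0} ^ n) \<partial>\<mu>) \<partial>\<theta>)"
      using False by (simp add: measure_pmf.emeasure_space_1)
    also have "\<dots> = emeasure (brw \<mu> \<theta>)
        {\<omega>. snd \<omega> [] \<in> UNIV \<and> (\<forall>i<fst \<omega> []. \<not> hits a m (shift i \<omega>) 0)}"
      by (rule emeasure_brw_children[symmetric]) measurable
    also have "{\<omega>. snd \<omega> [] \<in> UNIV \<and> (\<forall>i<fst \<omega> []. \<not> hits a m (shift i \<omega>) 0)} =
        space (brw \<mu> \<theta>) - B m"
      by (auto simp: B_def)
    finally show ?thesis using prob_compl[OF meas[of m]] by (simp add: emeasure_eq_measure)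
  qed
  have "incseq B"
    unfolding B_def hits_iff by (intro monoI Collect_mono) (meson order_trans)
  then have "(\<lambda>m. prob (B m)) \<longlonglongrightarrow> prob (\<Union>m. B m)"
    using meas by (intro finite_Lim_measure_incseq) auto
  then have "prob (\<Union>m. B m) \<le> w 0"
    by (rule LIMSEQ_le_const2) (simp add: B_le)
  also have "(\<Union>m. B m) = {\<omega> \<in> space (brw \<mu> \<theta>). visits \<omega> a}"
    using False by (auto simp: B_def visits_iff)
  finally show ?thesis .
qed

end

section \<open>The radial profile\<close>

definition \<psi> :: "real \<Rightarrow> real" where "\<psi> q = 1 / (q * ln q)"

text \<open>This and the next two are the first three derivatives of \<open>\<psi>\<close>, written
  in the terms \<open>1 / (q ^ n * ln q ^ k)\<close>, whose span is closed under
  differentiation.\<close>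

definition \<psi>\<^sub>1 :: "real \<Rightarrow> real" where
  "\<psi>\<^sub>1 q = - (1 / (q ^ 2 * ln q) + 1 / (q ^ 2 * ln q ^ 2))"

definition \<psi>\<^sub>2 :: "real \<Rightarrow> real" where
  "\<psi>\<^sub>2 q = 2 / (q ^ 3 * ln q) + 3 / (q ^ 3 * ln q ^ 2) + 2 / (q ^ 3 * ln q ^ 3)"

definition \<psi>\<^sub>3 :: "real \<Rightarrow> real" where
  "\<psi>\<^sub>3 q = - (6 / (q ^ 4 * ln q) + 11 / (q ^ 4 * ln q ^ 2) + 12 / (q ^ 4 * ln q ^ 3) + 6 / (q ^ 4 * ln q ^ 4))"

lemma deriv_inverse_power_ln:
  assumes "1 < q"
  shows "((\<lambda>q. 1 / (q ^ n * ln q ^ k)) has_real_derivative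
    - (real n / (q ^ Suc n * ln q ^ k) + real k / (q ^ Suc n * ln q ^ Suc k))) (at q)"
proof -
  have q: "0 < q" "0 < ln q" using assms by simp_all
  have "((\<lambda>q. inverse q ^ n * inverse (ln q) ^ k) has_real_derivative
    - (real n / (q ^ Suc n * ln q ^ k) + real k / (q ^ Suc n * ln q ^ Suc k))) (at q)"
  proof (rule DERIV_cong)
    show "((\<lambda>q. inverse q ^ n * inverse (ln q) ^ k) has_real_derivative
        real n * (- (inverse q ^ Suc (Suc 0)) * inverse q ^ (n - Suc 0)) * inverse (ln q) ^ k +
        real k * (- (inverse q * inverse (ln q ^ Suc (Suc 0))) * inverse (ln q) ^ (k - Suc 0)) * inverse q ^ n) (at q)"
      using q by (intro DERIV_mult DERIV_power DERIV_inverse DERIV_inverse_fun DERIV_ln) simp_all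
    \<comment> \<open>The exponent \<open>n - Suc 0\<close> is truncated at \<open>n = 0\<close>,
      where the factor \<open>real n\<close> vanishes; the same happens for
      \<open>k\<close>.\<close>
    have n: "real n * (- (inverse q ^ Suc (Suc 0)) * inverse q ^ (n - Suc 0)) = - (real n / q ^ Suc n)"
      using q by (cases n) (simp_all add: divide_inverse power_inverse)
    have k: "real k * (- (inverse q * inverse (ln q ^ Suc (Suc 0))) * inverse (ln q) ^ (k - Suc 0)) =
        - (real k / (q * ln q ^ Suc k))"
      using q by (cases k) (simp_all add: divide_inverse power_inverse)
    show "real n * (- (inverse q ^ Suc (Suc 0)) * inverse q ^ (n - Suc 0)) * inverse (ln q) ^ k +
        real k * (- (inverse q * inverse (ln q ^ Suc (Suc 0))) * inverse (ln q) ^ (k - Suc 0)) * inverse q ^ n =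
        - (real n / (q ^ Suc n * ln q ^ k) + real k / (q ^ Suc n * ln q ^ Suc k))"
      unfolding n k by (simp add: divide_inverse power_inverse)
  qed
  then show ?thesis by (simp add: inverse_eq_divide power_divide)
qed

lemma deriv_psi:
  assumes "1 < q"
  shows "(\<psi> has_real_derivative \<psi>\<^sub>1 q) (at q)"
    and "(\<psi>\<^sub>1 has_real_derivative \<psi>\<^sub>2 q) (at q)"
    and "(\<psi>\<^sub>2 has_real_derivative \<psi>\<^sub>3 q) (at q)"
proof -
  note D = deriv_inverse_power_ln[OF assms]
  show "(\<psi> has_real_derivative \<psi>\<^sub>1 q) (at q)"
    using D[of 1 1] by (simp add: \<psi>_def[abs_def] \<psi>\<^sub>1_def eval_nat_numeral)
  show "(\<psi>\<^sub>1 has_real_derivative \<psi>\<^sub>2 q) (at q)"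
    using DERIV_minus[OF DERIV_add[OF D[of 2 1] D[of 2 2]]]
    by (simp add: \<psi>\<^sub>1_def[abs_def] \<psi>\<^sub>2_def eval_nat_numeral algebra_simps)
  show "(\<psi>\<^sub>2 has_real_derivative \<psi>\<^sub>3 q) (at q)"
    using DERIV_add[OF DERIV_add[OF DERIV_cmult[OF D[of 3 1], of 2] DERIV_cmult[OF D[of 3 2], of 3]]
      DERIV_cmult[OF D[of 3 3], of 2]]
    by (simp add: \<psi>\<^sub>2_def[abs_def] \<psi>\<^sub>3_def eval_nat_numeral algebra_simps)
qed

lemma psi_Taylor:
  assumes "1 < q" "1 < q + \<delta>"
  obtains t where "min q (q + \<delta>) \<le> t" "t \<le> max q (q + \<delta>)"
    "\<psi> (q + \<delta>) = \<psi> q + \<psi>\<^sub>1 q * \<delta> + \<psi>\<^sub>2 q * \<delta> ^ 2 / 2 + \<psi>\<^sub>3 t * \<delta> ^ 3 / 6"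
proof (cases "\<delta> = 0")
  case True
  then show ?thesis using that[of q] by simp
next
  case False
  define d where "d m = [\<psi>, \<psi>\<^sub>1, \<psi>\<^sub>2, \<psi>\<^sub>3] ! m" for m
  have "\<exists>t. (if q + \<delta> < q then q + \<delta> < t \<and> t < q else q < t \<and> t < q + \<delta>) \<and>
      \<psi> (q + \<delta>) = (\<Sum>m<3. d m q / fact m * ((q + \<delta>) - q) ^ m) + d 3 t / fact 3 * ((q + \<delta>) - q) ^ 3"
  proof (rule Taylor[where a="min q (q + \<delta>)" and b="max q (q + \<delta>)"])
    show "\<forall>m t. m < 3 \<and> min q (q + \<delta>) \<le> t \<and> t \<le> max q (q + \<delta>) \<longrightarrow>
        (d m has_real_derivative d (Suc m) t) (at t)"
    proof (intro allI impI)
      fix m :: nat and t assume t: "m < 3 \<and> min q (q + \<delta>) \<le> t \<and> t \<le> max q (q + \<delta>)"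
      then have "1 < t" using assms by linarith
      moreover have "m = 0 \<or> m = 1 \<or> m = 2" using t by linarith
      ultimately show "(d m has_real_derivative d (Suc m) t) (at t)"
        using deriv_psi[of t] by (auto simp: d_def)
    qed
  qed (use False in \<open>auto simp: d_def\<close>)
  then obtain t where t: "if q + \<delta> < q then q + \<delta> < t \<and> t < q else q < t \<and> t < q + \<delta>"
    "\<psi> (q + \<delta>) = (\<Sum>m<3. d m q / fact m * ((q + \<delta>) - q) ^ m) + d 3 t / fact 3 * ((q + \<delta>) - q) ^ 3"
    by blast
  show ?thesis
  proof (rule that[of t])
    show "min q (q + \<delta>) \<le> t" "t \<le> max q (q + \<delta>)"
      using t(1) by (auto split: if_splits)
    show "\<psi> (q + \<delta>) = \<psi> q + \<psi>\<^sub>1 q * \<delta> + \<psi>\<^sub>2 q * \<delta> ^ 2 / 2 + \<psi>\<^sub>3 t * \<delta> ^ 3 / 6"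
      unfolding t(2) by (simp add: d_def eval_nat_numeral lessThan_Suc)
  qed
qed

lemma one_le_ln: "1 \<le> ln q" if "3 \<le> q" for q :: real
  using that exp_le by (subst ln_ge_iff) linarith+

text \<open>The alternating signs give the cubic Taylor remainder a favourable sign for
  \<open>\<delta> \<ge> 0\<close> and make the quadratic Taylor polynomial nonnegative for
  \<open>\<delta> \<le> 0\<close>.\<close>

lemma psi_deriv_signs:
  assumes "1 < q"
  shows "0 < \<psi> q" "\<psi>\<^sub>1 q \<le> 0" "0 \<le> \<psi>\<^sub>2 q" "\<psi>\<^sub>3 q \<le> 0"
proof -
  have "0 < q" "0 < ln q" using assms by simp_all
  then show "0 < \<psi> q" "\<psi>\<^sub>1 q \<le> 0" "0 \<le> \<psi>\<^sub>2 q" "\<psi>\<^sub>3 q \<le> 0"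
    unfolding \<psi>_def \<psi>\<^sub>1_def \<psi>\<^sub>2_def \<psi>\<^sub>3_def neg_le_0_iff_le
    by - (simp, (intro add_nonneg_nonneg; simp)+)
qed

lemma psi_antimono: "\<psi> r \<le> \<psi> q" if "1 < q" "q \<le> r"
proof -
  have "0 < q" "0 < ln q" "ln q \<le> ln r" using that by simp_all
  then have "0 < q * ln q" "q * ln q \<le> r * ln r" using that by (simp, intro mult_mono) simp_all
  then show ?thesis unfolding \<psi>_def by (intro divide_left_mono) simp_all
qed

lemma psi2_le:
  assumes "3 \<le> q"
  shows "\<psi>\<^sub>2 q \<le> 7 / q ^ 3"
proof -
  have L: "1 \<le> ln q" using one_le_ln[OF assms] .
  have *: "1 / (q ^ 3 * ln q ^ k) \<le> 1 / q ^ 3" for k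
    using L assms one_le_power[OF L, of k] by (intro divide_left_mono) (auto simp: mult_le_cancel_left1)
  have "\<psi>\<^sub>2 q = 2 * (1 / (q ^ 3 * ln q ^ 1)) + 3 * (1 / (q ^ 3 * ln q ^ 2)) + 2 * (1 / (q ^ 3 * ln q ^ 3))"
    by (simp add: \<psi>\<^sub>2_def)
  also have "\<dots> \<le> 7 * (1 / q ^ 3)" using *[of 1] *[of 2] *[of 3] by linarith
  finally show ?thesis by simp
qed

text \<open>As for \<open>\<psi>\<^sub>2\<close>, with \<open>35 = 6 + 11 + 12 + 6\<close>.\<close>

lemma psi3_ge:
  assumes "3 \<le> q"
  shows "- (35 / q ^ 4) \<le> \<psi>\<^sub>3 q"
proof -
  have L: "1 \<le> ln q" using one_le_ln[OF assms] .
  have *: "1 / (q ^ 4 * ln q ^ k) \<le> 1 / q ^ 4" for k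
    using L assms one_le_power[OF L, of k] by (intro divide_left_mono) (auto simp: mult_le_cancel_left1)
  have "- (35 * (1 / q ^ 4)) \<le> - (6 * (1 / (q ^ 4 * ln q ^ 1)) + 11 * (1 / (q ^ 4 * ln q ^ 2)) +
      12 * (1 / (q ^ 4 * ln q ^ 3)) + 6 * (1 / (q ^ 4 * ln q ^ 4)))"
    using *[of 1] *[of 2] *[of 3] *[of 4] by linarith
  also have "\<dots> = \<psi>\<^sub>3 q" by (simp add: \<psi>\<^sub>3_def)
  finally show ?thesis by simp
qed

text \<open>The left side is the generator of the limiting Brownian motion in dimension 4 acting on
  a function of the quadratic form \<open>q\<close>. The terms in \<open>1 / (q ^ 2 * ln q)\<close>
  cancel because \<open>1 / q\<close> is harmonic.\<close>

lemma psi_Laplacian: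
  assumes "1 < q"
  shows "4 * \<psi>\<^sub>1 q + 2 * q * \<psi>\<^sub>2 q = 2 / (q ^ 2 * ln q ^ 2) + 4 / (q ^ 2 * ln q ^ 3)"
proof -
  have "q * (c / (q ^ 3 * y)) = c / (q ^ 2 * y)" for c y
    using assms by (simp add: eval_nat_numeral)
  then have "q * \<psi>\<^sub>2 q = 2 / (q ^ 2 * ln q) + 3 / (q ^ 2 * ln q ^ 2) + 2 / (q ^ 2 * ln q ^ 3)"
    unfolding \<psi>\<^sub>2_def distrib_left by simp
  then show ?thesis unfolding \<psi>\<^sub>1_def by simp
qed

text \<open>Here \<open>s\<close> is the size of the jump. An upward increment
  \<open>\<delta>\<close> may be of order \<open>s ^ 2\<close>, but there the cubic remainder is
  nonpositive; a downward one is at most linear in \<open>s\<close>, so the error involves only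
  \<open>s ^ 3\<close>.\<close>

lemma psi_increment_le:
  assumes q: "6 \<le> q" and \<delta>: "- (q / 2) \<le> \<delta>" "- \<delta> \<le> K * sqrt q * s" and K: "0 \<le> K" "0 \<le> s"
  shows "\<psi> (q + \<delta>) \<le> \<psi> q + \<psi>\<^sub>1 q * \<delta> + \<psi>\<^sub>2 q * \<delta> ^ 2 / 2 + 100 * K ^ 3 * s ^ 3 / sqrt q ^ 5"
proof -
  have q1: "1 < q" "1 < q + \<delta>" using q \<delta>(1) by linarith+
  obtain t where t: "min q (q + \<delta>) \<le> t" "t \<le> max q (q + \<delta>)"
    "\<psi> (q + \<delta>) = \<psi> q + \<psi>\<^sub>1 q * \<delta> + \<psi>\<^sub>2 q * \<delta> ^ 2 / 2 + \<psi>\<^sub>3 t * \<delta> ^ 3 / 6"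
    by (rule psi_Taylor[OF q1])
  \<comment> \<open>The threshold \<open>6 \<le> q\<close> ensures \<open>3 \<le> t\<close>, as
    \<open>psi3_ge\<close> requires.\<close>
  have t2: "q / 2 \<le> t" "3 \<le> t" using t(1) q \<delta>(1) by linarith+
  have "\<psi>\<^sub>3 t * \<delta> ^ 3 / 6 \<le> 100 * K ^ 3 * s ^ 3 / sqrt q ^ 5"
  proof (cases "0 \<le> \<delta>")
    case True
    then have "\<psi>\<^sub>3 t * \<delta> ^ 3 / 6 \<le> 0"
      using psi_deriv_signs(4)[of t] t2 by (simp add: mult_nonpos_nonneg)
    also have "\<dots> \<le> 100 * K ^ 3 * s ^ 3 / sqrt q ^ 5"
      using K q by simp
    finally show ?thesis .
  next
    case False
    \<comment> \<open>As \<open>q / 2 \<le> t\<close>, the constants are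
      \<open>560 = 35 * 2 ^ 4\<close> and finally \<open>560 / 6 \<le> 100\<close>.\<close>
    have "- \<psi>\<^sub>3 t \<le> 35 / t ^ 4" using psi3_ge[OF t2(2)] by simp
    also have "\<dots> \<le> 35 / (q / 2) ^ 4"
      using t2 q by (intro divide_left_mono power_mono mult_pos_pos) auto
    also have "\<dots> = 560 / sqrt q ^ 8"
    proof -
      have "sqrt q ^ 8 = (sqrt q ^ 2) ^ 4" by (simp flip: power_mult)
      also have "\<dots> = q ^ 4" using q by simp
      finally show ?thesis by (simp add: power_divide)
    qed
    finally have 1: "- \<psi>\<^sub>3 t \<le> 560 / sqrt q ^ 8" .
    have 2: "(- \<delta>) ^ 3 \<le> (K * sqrt q * s) ^ 3"
      using \<delta> False by (intro power_mono) auto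
    have "\<psi>\<^sub>3 t * \<delta> ^ 3 / 6 = (- \<psi>\<^sub>3 t) * (- \<delta>) ^ 3 / 6" by simp
    also have "\<dots> \<le> (560 / sqrt q ^ 8) * (K * sqrt q * s) ^ 3 / 6"
      using 1 2 False q by (intro divide_right_mono mult_mono) auto
    also have "\<dots> = (560 / 6) * (K ^ 3 * s ^ 3 / sqrt q ^ 5)"
      using q by (simp add: power_mult_distrib divide_simps)
    also have "\<dots> \<le> 100 * (K ^ 3 * s ^ 3 / sqrt q ^ 5)"
      using K q by (intro mult_right_mono) auto
    finally show ?thesis by simp
  qed
  with t(3) show ?thesis by simp
qed

text \<open>For \<open>q0 > 1\<close> and \<open>q > 1\<close> this is
  \<open>min 1 (C * \<psi> q)\<close> with \<open>C = 1 / \<psi> q0\<close>. The cut is made in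
  terms of \<open>q\<close>, so the formula for \<open>\<psi>\<close> is never evaluated near its
  singularity at \<open>q = 1\<close>.\<close>

definition barrier :: "real \<Rightarrow> real \<Rightarrow> real" where
  "barrier q0 q = (if q < q0 then 1 else \<psi> q / \<psi> q0)"

lemma barrier_bounds:
  assumes "1 < q0"
  shows "0 \<le> barrier q0 q" "barrier q0 q \<le> 1"
  using assms psi_deriv_signs(1)[of q0] psi_deriv_signs(1)[of q] psi_antimono[of q0 q]
  by (auto simp: barrier_def)

lemma barrier_le:
  assumes "1 < q0" "1 < q"
  shows "barrier q0 q \<le> \<psi> q / \<psi> q0"
  using assms psi_deriv_signs(1)[of q0] psi_antimono[of q q0] by (auto simp: barrier_def)

text \<open>Since \<open>\<psi>'\<close> is negative and \<open>\<psi>''\<close> positive, the second order Taylor polynomial is nonnegative for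
  \<open>\<delta> < 0\<close>. So on \<open>\<delta> < - q / 2\<close>, where Taylor's formula is useless, the trivial bound 1 can be paid
  for by the fifth moment alone.\<close>

lemma barrier_increment_le:
  assumes q0: "6 \<le> q0" "q0 \<le> q"
    and \<delta>: "- \<delta> \<le> K * sqrt q * s" and K: "0 \<le> K" "0 \<le> s"
  shows "barrier q0 (q + \<delta>) \<le>
    (\<psi> q + \<psi>\<^sub>1 q * \<delta> + \<psi>\<^sub>2 q * \<delta> ^ 2 / 2 + 100 * K ^ 3 * s ^ 3 / sqrt q ^ 5) / \<psi> q0 +
    32 * K ^ 5 * s ^ 5 / sqrt q ^ 5"
proof (cases "- (q / 2) \<le> \<delta>")
  case True
  have "barrier q0 (q + \<delta>) \<le> \<psi> (q + \<delta>) / \<psi> q0"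
    using True q0 by (intro barrier_le) linarith+
  also have "\<dots> \<le> (\<psi> q + \<psi>\<^sub>1 q * \<delta> + \<psi>\<^sub>2 q * \<delta> ^ 2 / 2 + 100 * K ^ 3 * s ^ 3 / sqrt q ^ 5) / \<psi> q0"
    using psi_increment_le[of q \<delta> K s] True assms psi_deriv_signs(1)[of q0]
    by (intro divide_right_mono) auto
  also have "\<dots> \<le> \<dots> + 32 * K ^ 5 * s ^ 5 / sqrt q ^ 5"
    using K q0 by simp
  finally show ?thesis .
next
  case False
  \<comment> \<open>A drop by more than \<open>q / 2\<close> forces
    \<open>sqrt q \<le> 2 * K * s\<close>, so the fifth-moment term, with \<open>32 = 2 ^ 5\<close>,
    is at least 1.\<close>
  have "sqrt q * sqrt q = q" using q0 by simp
  then have "sqrt q * (sqrt q / 2) < sqrt q * (K * s)" using False \<delta> by (simp add: mult_ac)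
  then have "sqrt q / 2 < K * s" by (rule mult_left_less_imp_less) (use q0 in simp)
  then have "sqrt q \<le> 2 * K * s" by simp
  then have "sqrt q ^ 5 \<le> (2 * K * s) ^ 5" using q0 by (intro power_mono) auto
  then have "1 \<le> 32 * K ^ 5 * s ^ 5 / sqrt q ^ 5"
    using q0 by (simp add: power_mult_distrib divide_simps)
  moreover have "0 \<le> (\<psi> q + \<psi>\<^sub>1 q * \<delta> + \<psi>\<^sub>2 q * \<delta> ^ 2 / 2 + 100 * K ^ 3 * s ^ 3 / sqrt q ^ 5) / \<psi> q0"
    using psi_deriv_signs[of q] psi_deriv_signs(1)[of q0] q0 False K
    by (intro divide_nonneg_pos add_nonneg_nonneg) (auto intro: mult_nonpos_nonpos)
  ultimately show ?thesis using barrier_bounds(2)[of q0 "q + \<delta>"] q0 by linarith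
qed

text \<open>Apply \<open>ln y \<le> y\<close> to the fourth root of \<open>q\<close>. This is what
  makes errors of order \<open>1 / sqrt q ^ 5\<close> comparable to
  \<open>\<psi> q ^ 2\<close>.\<close>

lemma ln_squared_le: "ln q ^ 2 \<le> 16 * sqrt q" if "1 \<le> q"
proof -
  have "ln q = 4 * ln (sqrt (sqrt q))" using that by (simp add: ln_sqrt)
  also have "\<dots> \<le> 4 * sqrt (sqrt q)" using that ln_le_minus_one[of "sqrt (sqrt q)"] by simp
  finally have "ln q ^ 2 \<le> (4 * sqrt (sqrt q)) ^ 2" using that by (intro power_mono) auto
  also have "\<dots> = 16 * sqrt q" using that by (simp add: power_mult_distrib)
  finally show ?thesis .
qed

text \<open>The numbers \<open>4\<close> and \<open>m\<close> stand for the first two moments of the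
  increment of the form. The factor of \<open>\<psi> q ^ 2\<close> does not depend on
  \<open>q0\<close>, so \<open>q0\<close> can be chosen afterwards; its part
  \<open>6 = 2 + 4\<close> comes from \<open>psi_Laplacian\<close>.\<close>

lemma barrier_expansion_le:
  assumes q0: "6 \<le> q0" "q0 \<le> q" and AB: "0 \<le> A" "0 \<le> B" "0 \<le> D" "0 \<le> E"
    and m: "m \<le> 4 * q + A * sqrt q + B"
  shows "(\<psi> q + \<psi>\<^sub>1 q * 4 + \<psi>\<^sub>2 q * m / 2 + D / sqrt q ^ 5) / \<psi> q0 + E / sqrt q ^ 5 \<le>
    (\<psi> q + (6 + 16 * (4 * (A + B) + D + E)) * \<psi> q ^ 2) / \<psi> q0"
proof -
  have q: "6 \<le> q" using q0 by simp
  have L: "1 \<le> ln q" using one_le_ln[of q] q by simp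
  have g: "1 \<le> sqrt q" "sqrt q ^ 2 = q" using q by auto
  have psi2: "\<psi> q ^ 2 = 1 / (q ^ 2 * ln q ^ 2)" by (simp add: \<psi>_def power_mult_distrib power_divide)
  have g5: "1 / sqrt q ^ 5 \<le> 16 * \<psi> q ^ 2"
  proof -
    have "x ^ 5 = (x ^ 2) ^ 2 * x" for x :: real
      by (simp add: eval_nat_numeral)
    from this[of "sqrt q"] have "sqrt q ^ 5 = q ^ 2 * sqrt q"
      unfolding g(2) .
    moreover have "1 / sqrt q \<le> 16 / ln q ^ 2"
      using ln_squared_le[of q] L q g by (simp add: divide_simps)
    then have "(1 / q ^ 2) * (1 / sqrt q) \<le> (1 / q ^ 2) * (16 / ln q ^ 2)"
      using q by (intro mult_left_mono) auto
    ultimately show ?thesis by (simp add: psi2)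
  qed
  have "\<psi>\<^sub>2 q * m / 2 \<le> \<psi>\<^sub>2 q * (4 * q + A * sqrt q + B) / 2"
    using psi_deriv_signs(3)[of q] q m by (intro divide_right_mono mult_left_mono) auto
  also have "\<dots> = 2 * q * \<psi>\<^sub>2 q + \<psi>\<^sub>2 q * (A * sqrt q + B) / 2"
    by (simp add: field_simps)
  also have "\<psi>\<^sub>2 q * (A * sqrt q + B) / 2 \<le> (7 / q ^ 3) * ((A + B) * sqrt q) / 2"
  proof (intro divide_right_mono mult_mono)
    have "B * 1 \<le> B * sqrt q" using AB g by (intro mult_left_mono) auto
    then show "A * sqrt q + B \<le> (A + B) * sqrt q" by (simp add: algebra_simps)
  qed (use q AB psi2_le[of q] in auto)
  also have "(7 / q ^ 3) * ((A + B) * sqrt q) / 2 = (7 / 2) * (A + B) * (1 / sqrt q ^ 5)"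
  proof -
    have "(x ^ 2) ^ 3 = x ^ 5 * x" for x :: real
      by (simp add: eval_nat_numeral)
    from this[of "sqrt q"] have "q ^ 3 = sqrt q ^ 5 * sqrt q"
      unfolding g(2) .
    then show ?thesis using g by simp
  qed
  also have "\<dots> \<le> 4 * (A + B) * (1 / sqrt q ^ 5)"
    using AB g by (intro mult_right_mono) auto
  finally have main: "\<psi>\<^sub>1 q * 4 + \<psi>\<^sub>2 q * m / 2 \<le>
      (4 * \<psi>\<^sub>1 q + 2 * q * \<psi>\<^sub>2 q) + 4 * (A + B) * (1 / sqrt q ^ 5)" by simp
  have leading: "4 * \<psi>\<^sub>1 q + 2 * q * \<psi>\<^sub>2 q \<le> 6 * \<psi> q ^ 2"
  proof -
    have "4 / (q ^ 2 * ln q ^ 3) \<le> 4 / (q ^ 2 * ln q ^ 2)"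
      using L q by (intro divide_left_mono mult_left_mono mult_pos_pos power_increasing) auto
    then show ?thesis using psi_Laplacian[of q] q by (simp add: psi2)
  qed
  have "s + a + b + D * x \<le> s + 6 * p + (z + D) * x"
    if "u \<le> 6 * p" "a + b \<le> u + z * x" for a b p s u x z :: real
    using that by (simp add: distrib_right)
  from this[OF leading main] have 1: "(\<psi> q + \<psi>\<^sub>1 q * 4 + \<psi>\<^sub>2 q * m / 2 + D / sqrt q ^ 5) \<le>
      \<psi> q + 6 * \<psi> q ^ 2 + (4 * (A + B) + D) * (1 / sqrt q ^ 5)"
    by simp
  have pos: "0 < \<psi> q0" using psi_deriv_signs(1)[of q0] q0 by simp
  \<comment> \<open>Allows the large-jump error, which lacks the factor
    \<open>1 / \<psi> q0\<close>, to be put under the common denominator.\<close>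
  have "\<psi> q0 \<le> 1"
    using mult_mono[of 1 q0 1 "ln q0"] one_le_ln[of q0] q0 by (simp add: \<psi>_def)
  then have "E / sqrt q ^ 5 * \<psi> q0 \<le> E / sqrt q ^ 5 * 1"
    using AB q by (intro mult_left_mono) auto
  then have 2: "E / sqrt q ^ 5 \<le> E / sqrt q ^ 5 / \<psi> q0"
    using pos by (simp only: pos_le_divide_eq mult_1_right)
  have "(\<psi> q + \<psi>\<^sub>1 q * 4 + \<psi>\<^sub>2 q * m / 2 + D / sqrt q ^ 5) / \<psi> q0 + E / sqrt q ^ 5 \<le>
      (\<psi> q + 6 * \<psi> q ^ 2 + (4 * (A + B) + D) * (1 / sqrt q ^ 5)) / \<psi> q0 + E / sqrt q ^ 5 / \<psi> q0"
    by (rule add_mono[OF divide_right_mono[OF 1 less_imp_le[OF pos]] 2])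
  also have "\<dots> = (\<psi> q + 6 * \<psi> q ^ 2 + (4 * (A + B) + D + E) * (1 / sqrt q ^ 5)) / \<psi> q0"
    by (simp add: add_divide_distrib)
  also have "\<dots> \<le> (\<psi> q + 6 * \<psi> q ^ 2 + (4 * (A + B) + D + E) * (16 * \<psi> q ^ 2)) / \<psi> q0"
    using g5 pos AB by (intro divide_right_mono add_left_mono mult_left_mono) auto
  also have "\<dots> = (\<psi> q + (6 + 16 * (4 * (A + B) + D + E)) * \<psi> q ^ 2) / \<psi> q0"
    by (simp add: algebra_simps)
  finally show ?thesis .
qed

section \<open>One step of the walk\<close>

lemma integrable_norm_power_mono:
  fixes X :: "'a \<Rightarrow> 'b :: {real_normed_vector, second_countable_topology}"
  assumes "integrable (measure_pmf p) (\<lambda>x. norm (X x) ^ n)" "k \<le> n"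
  shows "integrable (measure_pmf p) (\<lambda>x. norm (X x) ^ k)"
proof (rule Bochner_Integration.integrable_bound)
  show "integrable (measure_pmf p) (\<lambda>x. 1 + norm (X x) ^ n)"
    using assms(1) by simp
  have "t ^ k \<le> 1 + t ^ n" if "0 \<le> t" for t :: real
  proof (cases "t \<le> 1")
    case True
    then show ?thesis using that power_le_one[of t k] by (simp add: add_increasing2)
  next
    case False
    then have "t ^ k \<le> t ^ n" using assms(2) by (intro power_increasing) simp_all
    then show ?thesis by linarith
  qed
  then show "AE x in measure_pmf p. norm (norm (X x) ^ k) \<le> norm (1 + norm (X x) ^ n)"
    by (simp add: add_nonneg_nonneg)
qed simp

lemma integrable_pmf_dominated:
  fixes f :: "'a \<Rightarrow> 'b :: {banach, second_countable_topology}"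
  assumes "integrable (measure_pmf p) g" "\<And>x. norm (f x) \<le> g x"
  shows "integrable (measure_pmf p) f"
  using assms(1)
proof (rule Bochner_Integration.integrable_bound)
  show "AE x in measure_pmf p. norm (f x) \<le> norm (g x)"
    using order_trans[OF assms(2) abs_ge_self] by simp
qed simp

text \<open>The second-moment operator \<open>G\<close> is positive definite, as a vanishing form
  would make the support orthogonal to some nonzero \<open>u\<close>; hence it is invertible and
  \<open>A\<close> is its inverse. The last identity is where the dimension enters.\<close>

lemma inverse_covariance:
  fixes X :: "'a \<Rightarrow> 'v :: euclidean_space"
  assumes X2: "integrable (measure_pmf p) (\<lambda>x. norm (X x) ^ 2)"
    and nondegenerate: "\<And>u. (\<forall>x\<in>set_pmf p. u \<bullet> X x = 0) \<Longrightarrow> u = 0"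
  obtains A :: "'v \<Rightarrow> 'v" where "linear A" "\<And>x y. A x \<bullet> y = x \<bullet> A y" "\<And>x. x \<noteq> 0 \<Longrightarrow> 0 < x \<bullet> A x"
    "\<And>x. (\<integral>y. (A x \<bullet> X y) ^ 2 \<partial>p) = x \<bullet> A x" "(\<integral>y. X y \<bullet> A (X y) \<partial>p) = DIM('v)"
proof -
  define G where "G u = (\<integral>y. (u \<bullet> X y) *\<^sub>R X y \<partial>p)" for u
  have int: "integrable (measure_pmf p) (\<lambda>y. (u \<bullet> X y) *\<^sub>R X y)" for u
  proof (rule integrable_pmf_dominated)
    show "integrable (measure_pmf p) (\<lambda>y. norm u * norm (X y) ^ 2)" using X2 by simp
    show "norm ((u \<bullet> X y) *\<^sub>R X y) \<le> norm u * norm (X y) ^ 2" for y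
      using mult_right_mono[OF Cauchy_Schwarz_ineq2[of u "X y"], of "norm (X y)"]
      by (simp add: power2_eq_square mult.assoc)
  qed
  have int2: "integrable (measure_pmf p) (\<lambda>y. (u \<bullet> X y) * (v \<bullet> X y))" for u v
    using integrable_inner_left[OF int[of u], of v] by (simp add: inner_commute)
  have G_inner: "G u \<bullet> v = (\<integral>y. (u \<bullet> X y) * (v \<bullet> X y) \<partial>p)" for u v
    unfolding G_def using integral_inner_left[OF int[of u], of v] by (simp add: inner_commute)
  have "linear G"
  proof (rule linearI)
    show "G (u + v) = G u + G v" for u v
      by (rule euclidean_eqI) (simp add: G_inner inner_add_left distrib_right int2)
    show "G (r *\<^sub>R u) = r *\<^sub>R G u" for r u
      by (rule euclidean_eqI) (simp add: G_inner mult.assoc)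
  qed
  have G_pos: "0 < G u \<bullet> u" if "u \<noteq> 0" for u
  proof (rule ccontr)
    assume "\<not> 0 < G u \<bullet> u"
    then have "(\<integral>y. (u \<bullet> X y) * (u \<bullet> X y) \<partial>p) = 0"
      unfolding G_inner by (intro antisym integral_nonneg_AE) simp_all
    then have "AE y in p. (u \<bullet> X y) * (u \<bullet> X y) = 0"
      by (subst (asm) integral_nonneg_eq_0_iff_AE[OF int2]) auto
    then have "u = 0" by (intro nondegenerate) (simp add: AE_measure_pmf_iff)
    with that show False by simp
  qed
  have "inj G"
    unfolding linear_injective_0[OF \<open>linear G\<close>] using G_pos by force
  then obtain A where A: "linear A" "\<And>x. A (G x) = x" "\<And>x. G (A x) = x"
    using linear_injective_isomorphism[OF \<open>linear G\<close>] by metis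
  have A_inner: "x \<bullet> A y = (\<integral>z. (A x \<bullet> X z) * (A y \<bullet> X z) \<partial>p)" for x y
    using G_inner[of "A x" "A y"] by (simp add: A)
  have sym: "A x \<bullet> y = x \<bullet> A y" for x y
    using A_inner[of x y] A_inner[of y x] by (simp add: inner_commute mult.commute)
  have "0 < x \<bullet> A x" if "x \<noteq> 0" for x
  proof -
    have "A x \<noteq> 0" using that A(3)[of x] linear_0[OF \<open>linear G\<close>] by metis
    then show ?thesis using G_pos[of "A x"] by (simp add: A)
  qed
  moreover have "(\<integral>y. (A x \<bullet> X y) ^ 2 \<partial>p) = x \<bullet> A x" for x
    unfolding A_inner power2_eq_square ..
  moreover have "(\<integral>y. X y \<bullet> A (X y) \<partial>p) = DIM('v)"
  proof -
    \<comment> \<open>Expanding in the standard basis gives the trace of \<open>G\<close> after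
      \<open>A\<close>, which is the identity.\<close>
    have "(\<integral>y. X y \<bullet> A (X y) \<partial>p) = (\<integral>y. (\<Sum>b\<in>Basis. (A b \<bullet> X y) * (b \<bullet> X y)) \<partial>p)"
      by (subst euclidean_inner) (simp add: sym mult.commute inner_commute)
    also have "\<dots> = (\<Sum>b\<in>Basis. G (A b) \<bullet> b)"
      unfolding G_inner by (rule Bochner_Integration.integral_sum) (rule int2)
    also have "\<dots> = DIM('v)" by (simp add: A)
    finally show ?thesis .
  qed
  ultimately show ?thesis
    using A(1) sym that[of A] by blast
qed

text \<open>The constant is the minimum over the compact unit sphere, extended by
  homogeneity.\<close>

lemma quadratic_form_lower_bound:
  fixes A :: "'v :: euclidean_space \<Rightarrow> 'v"
  assumes "linear A" "\<And>x. x \<noteq> 0 \<Longrightarrow> 0 < x \<bullet> A x"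
  obtains c where "0 < c" "\<And>x. c * norm x ^ 2 \<le> x \<bullet> A x"
proof -
  have "continuous_on (sphere 0 1) (\<lambda>x. x \<bullet> A x)"
    by (intro continuous_intros linear_continuous_on linear_conv_bounded_linear[THEN iffD1] assms)
  moreover have "sphere 0 1 \<noteq> ({} :: 'v set)" by simp
  ultimately obtain u where u: "norm u = 1" "\<And>x. norm x = 1 \<Longrightarrow> u \<bullet> A u \<le> x \<bullet> A x"
    using continuous_attains_inf[OF compact_sphere, of 0 1 "\<lambda>x. x \<bullet> A x"] by auto
  show ?thesis
  proof (rule that[of "u \<bullet> A u"])
    show "0 < u \<bullet> A u" using u(1) by (intro assms(2)) auto
    fix x :: 'v
    show "u \<bullet> A u * norm x ^ 2 \<le> x \<bullet> A x"
    proof (cases "x = 0")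
      case False
      have "u \<bullet> A u \<le> (x /\<^sub>R norm x) \<bullet> A (x /\<^sub>R norm x)"
        using False by (intro u(2)) simp
      also have "\<dots> = (x \<bullet> A x) / norm x ^ 2"
        unfolding linear_scale[OF assms(1)] inner_scaleR_left inner_scaleR_right
        by (simp only: power2_eq_square divide_inverse inverse_mult_distrib mult_ac)
      finally show ?thesis by (subst (asm) pos_le_divide_eq) (use False in simp_all)
    qed (simp add: linear_0[OF assms(1)])
  qed
qed

text \<open>Integrates \<open>barrier_increment_le\<close>. The increment of the form has mean
  exactly 4, because its linear part is centred, and second moment at most \<open>4 * q\<close> plus
  terms of order \<open>sqrt q\<close>.\<close>

lemma expectation_barrier_le:
  fixes X :: "'a \<Rightarrow> 'v :: euclidean_space"
  assumes mean: "has_bochner_integral (measure_pmf p) X 0"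
    and X5: "integrable (measure_pmf p) (\<lambda>y. norm (X y) ^ 5)"
    and A: "linear A" "\<And>x y. A x \<bullet> y = x \<bullet> A y"
    and c: "0 < c" "\<And>x. c * norm x ^ 2 \<le> x \<bullet> A x"
    and cov: "\<And>x. (\<integral>y. (A x \<bullet> X y) ^ 2 \<partial>p) = x \<bullet> A x" "(\<integral>y. X y \<bullet> A (X y) \<partial>p) = 4"
  shows "\<exists>C. \<forall>q0\<ge>6. \<forall>x. q0 \<le> x \<bullet> A x \<longrightarrow>
    (\<integral>y. barrier q0 ((x + X y) \<bullet> A (x + X y)) \<partial>p) \<le>
      (\<psi> (x \<bullet> A x) + C * \<psi> (x \<bullet> A x) ^ 2) / \<psi> q0"
proof -
  obtain B where B: "0 < B" "\<And>x. norm (A x) \<le> B * norm x"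
    using linear_bounded_pos[OF A(1)] by auto
  have int: "integrable (measure_pmf p) (\<lambda>y. norm (X y) ^ k)" if "k \<le> 5" for k
    by (rule integrable_norm_power_mono[OF X5 that])
  define M where "M k = (\<integral>y. norm (X y) ^ k \<partial>p)" for k
  have M: "0 \<le> M k" for k unfolding M_def by (intro integral_nonneg_AE) simp
  define K where "K = 2 * B / sqrt c"
  \<comment> \<open>\<open>E1\<close> and \<open>E2\<close> bound the mixed and the quartic part of
    the second moment of the increment; \<open>E3\<close> and \<open>E4\<close> come from the two
    error terms of \<open>barrier_increment_le\<close>.\<close>
  define E1 E2 E3 E4 where "E1 = 4 * B ^ 2 * M 3 / sqrt c" and "E2 = B ^ 2 * M 4"
    and "E3 = 100 * K ^ 3 * M 3" and "E4 = 32 * K ^ 5 * M 5"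
  have K: "0 \<le> K" using B c by (simp add: K_def)
  have E: "0 \<le> E1" "0 \<le> E2" "0 \<le> E3" "0 \<le> E4"
    using M K B c by (simp_all add: E1_def E2_def E3_def E4_def)
  have Q_le: "\<bar>x \<bullet> A x\<bar> \<le> B * norm x ^ 2" for x
  proof -
    have "\<bar>x \<bullet> A x\<bar> \<le> norm x * norm (A x)" by (rule Cauchy_Schwarz_ineq2)
    also have "\<dots> \<le> norm x * (B * norm x)" using B by (intro mult_left_mono) auto
    finally show ?thesis by (simp add: power2_eq_square mult_ac)
  qed
  have lin_le: "\<bar>A x \<bullet> z\<bar> \<le> B * norm x * norm z" for x z
    using Cauchy_Schwarz_ineq2[of "A x" z] mult_right_mono[OF B(2)[of x], of "norm z"] by simp
  show ?thesis
  proof (intro exI[of _ "6 + 16 * (4 * (E1 + E2) + E3 + E4)"] allI impI)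
    fix q0 :: real and x :: 'v
    assume q0: "6 \<le> q0" "q0 \<le> x \<bullet> A x"
    define q where "q = x \<bullet> A x"
    define \<delta> where "\<delta> y = 2 * (A x \<bullet> X y) + X y \<bullet> A (X y)" for y
    have Q_add: "(x + X y) \<bullet> A (x + X y) = q + \<delta> y" for y
    proof -
      have "x \<bullet> A (X y) = A x \<bullet> X y" by (rule A(2)[symmetric])
      moreover have "X y \<bullet> A x = A x \<bullet> X y" by (rule inner_commute)
      ultimately show ?thesis
        by (simp add: q_def \<delta>_def linear_add[OF A(1)] inner_add_left inner_add_right)
    qed
    have q: "6 \<le> q" using q0 by (simp add: q_def)
    have norm_x: "norm x \<le> sqrt q / sqrt c"
    proof -
      have "norm x ^ 2 \<le> q / c" using c(2)[of x] c(1) by (simp add: q_def pos_le_divide_eq mult.commute)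
      then show ?thesis using real_le_rsqrt[of "norm x" "q / c"] by (simp add: real_sqrt_divide)
    qed
    \<comment> \<open>The quadratic part of the increment is nonnegative, so only the linear part
      can lower the form.\<close>
    have \<delta>_ge: "- \<delta> y \<le> K * sqrt q * norm (X y)" for y
    proof -
      have "0 \<le> X y \<bullet> A (X y)" using c(1) by (intro order_trans[OF _ c(2)[of "X y"]]) simp
      then have "- \<delta> y \<le> 2 * (B * norm x * norm (X y))"
        using lin_le[of x "X y"] by (simp add: \<delta>_def abs_le_iff)
      also have "\<dots> \<le> 2 * (B * (sqrt q / sqrt c) * norm (X y))"
        using norm_x B by (intro mult_left_mono mult_right_mono) auto
      finally show ?thesis by (simp add: K_def)
    qed
    have int_lin: "integrable (measure_pmf p) (\<lambda>y. A x \<bullet> X y)" "(\<integral>y. A x \<bullet> X y \<partial>p) = 0"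
      using mean by (auto simp: has_bochner_integral_iff)
    have int_Q: "integrable (measure_pmf p) (\<lambda>y. X y \<bullet> A (X y))"
      by (rule integrable_pmf_dominated[where g="\<lambda>y. B * norm (X y) ^ 2"]) (use int[of 2] Q_le in auto)
    have int_\<delta>: "integrable (measure_pmf p) \<delta>" "(\<integral>y. \<delta> y \<partial>p) = 4"
      unfolding \<delta>_def using int_lin int_Q cov(2) by simp_all
    have int_lin2: "integrable (measure_pmf p) (\<lambda>y. (A x \<bullet> X y) ^ 2)"
    proof (rule integrable_pmf_dominated[where g="\<lambda>y. (B * norm x) ^ 2 * norm (X y) ^ 2"])
      show "norm ((A x \<bullet> X y) ^ 2) \<le> (B * norm x) ^ 2 * norm (X y) ^ 2" for y
        using power_mono[OF lin_le[of x "X y"], of 2] by (simp add: power_mult_distrib)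
    qed (use int[of 2] in simp)
    let ?g = "\<lambda>y. 4 * (A x \<bullet> X y) ^ 2 + 4 * B ^ 2 * norm x * norm (X y) ^ 3 + B ^ 2 * norm (X y) ^ 4"
    have \<delta>2_le: "\<delta> y ^ 2 \<le> ?g y" for y
    proof -
      have "\<delta> y ^ 2 = 4 * (A x \<bullet> X y) ^ 2 + 4 * ((A x \<bullet> X y) * (X y \<bullet> A (X y))) + (X y \<bullet> A (X y)) ^ 2"
        by (simp add: \<delta>_def power2_eq_square algebra_simps)
      also have "(A x \<bullet> X y) * (X y \<bullet> A (X y)) \<le> \<bar>A x \<bullet> X y\<bar> * \<bar>X y \<bullet> A (X y)\<bar>"
        by (simp flip: abs_mult)
      also have "\<dots> \<le> (B * norm x * norm (X y)) * (B * norm (X y) ^ 2)"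
        using lin_le Q_le B by (intro mult_mono) auto
      also have "\<dots> = B ^ 2 * norm x * norm (X y) ^ 3"
        by (simp add: eval_nat_numeral)
      also have "(X y \<bullet> A (X y)) ^ 2 \<le> (B * norm (X y) ^ 2) ^ 2"
        using power_mono[OF Q_le[of "X y"], of 2] by simp
      also have "\<dots> = B ^ 2 * norm (X y) ^ 4"
        by (simp add: power_mult_distrib flip: power_mult)
      finally show ?thesis by simp
    qed
    have int_g: "integrable (measure_pmf p) ?g"
      using int_lin2 int[of 3] int[of 4] by simp
    have int_\<delta>2: "integrable (measure_pmf p) (\<lambda>y. \<delta> y ^ 2)"
      using int_g by (rule integrable_pmf_dominated) (simp add: \<delta>2_le)
    define m where "m = (\<integral>y. \<delta> y ^ 2 \<partial>p)"
    have "m \<le> (\<integral>y. ?g y \<partial>p)"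
      unfolding m_def by (intro integral_mono int_\<delta>2 int_g \<delta>2_le)
    also have "\<dots> = 4 * q + 4 * B ^ 2 * norm x * M 3 + B ^ 2 * M 4"
      using int_lin2 int[of 3] int[of 4] cov(1)[of x] by (simp add: M_def q_def)
    also have "\<dots> \<le> 4 * q + 4 * B ^ 2 * (sqrt q / sqrt c) * M 3 + B ^ 2 * M 4"
      using norm_x B M by (intro add_mono mult_left_mono mult_right_mono) auto
    also have "\<dots> = 4 * q + E1 * sqrt q + E2"
      by (simp add: E1_def E2_def)
    finally have m: "m \<le> 4 * q + E1 * sqrt q + E2" .
    let ?h = "\<lambda>y. (\<psi> q + \<psi>\<^sub>1 q * \<delta> y + \<psi>\<^sub>2 q * \<delta> y ^ 2 / 2 + 100 * K ^ 3 * norm (X y) ^ 3 / sqrt q ^ 5) / \<psi> q0 +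
      32 * K ^ 5 * norm (X y) ^ 5 / sqrt q ^ 5"
    have "(\<integral>y. barrier q0 ((x + X y) \<bullet> A (x + X y)) \<partial>p) = (\<integral>y. barrier q0 (q + \<delta> y) \<partial>p)"
      by (simp add: Q_add)
    also have "\<dots> \<le> (\<integral>y. ?h y \<partial>p)"
    proof (rule integral_mono)
      show "integrable (measure_pmf p) (\<lambda>y. barrier q0 (q + \<delta> y))"
        using barrier_bounds[of q0] q0 by (intro measure_pmf.integrable_const_bound[of _ 1]) auto
      show "integrable (measure_pmf p) ?h"
        using int_\<delta> int_\<delta>2 int[of 3] int[of 5] by simp
      show "barrier q0 (q + \<delta> y) \<le> ?h y" for y
        using q0 K by (intro barrier_increment_le \<delta>_ge) (auto simp: q_def)
    qed
    also have "\<dots> = (\<psi> q + \<psi>\<^sub>1 q * 4 + \<psi>\<^sub>2 q * m / 2 + E3 / sqrt q ^ 5) / \<psi> q0 + E4 / sqrt q ^ 5"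
      using int_\<delta> int_\<delta>2 int[of 3] int[of 5] by (simp add: m_def M_def E3_def E4_def)
    also have "\<dots> \<le> (\<psi> q + (6 + 16 * (4 * (E1 + E2) + E3 + E4)) * \<psi> q ^ 2) / \<psi> q0"
      using q0 E m by (intro barrier_expansion_le) (auto simp: q_def)
    finally show "(\<integral>y. barrier q0 ((x + X y) \<bullet> A (x + X y)) \<partial>p) \<le>
      (\<psi> (x \<bullet> A x) + (6 + 16 * (4 * (E1 + E2) + E3 + E4)) * \<psi> (x \<bullet> A x) ^ 2) / \<psi> q0"
      by (simp add: q_def)
  qed
qed

section \<open>The offspring generating function\<close>

lemma Bernoulli_second_order:
  fixes t :: real
  assumes "0 \<le> t" "t \<le> 1"
  shows "1 - real n * t + indicator {2..} n * t ^ 2 \<le> (1 - t) ^ n"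
proof (cases "2 \<le> n")
  case True
  then show ?thesis
  proof (induction n rule: dec_induct)
    \<comment> \<open>Equality holds at \<open>n = 2\<close>; each further factor
      \<open>1 - t\<close> leaves the surplus \<open>t ^ 2 * (n - t)\<close>.\<close>
    case base
    then show ?case by (simp add: power2_eq_square algebra_simps)
  next
    case (step n)
    have "(1 - real n * t + t ^ 2) * (1 - t) \<le> (1 - t) ^ n * (1 - t)"
      using step assms by (intro mult_right_mono) auto
    moreover have "(1 - real n * t + t ^ 2) * (1 - t) =
        1 - real (Suc n) * t + t ^ 2 + t ^ 2 * (real n - t)"
      by (simp add: power2_eq_square algebra_simps)
    moreover have "0 \<le> t ^ 2 * (real n - t)" using step(1) assms by simp
    ultimately show ?case using step(1) by (simp add: mult.commute)
  qed
next
  case False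
  then have "n = 0 \<or> n = 1" by linarith
  then show ?thesis by auto
qed

text \<open>Criticality makes the linear term exactly \<open>t\<close>. The quadratic gain is
  measured by the mass of \<open>{2..}\<close>, since the variance may be infinite.\<close>

lemma offspring_gf_ge:
  fixes t :: real
  assumes "has_bochner_integral (measure_pmf \<mu>) real 1" "0 \<le> t" "t \<le> 1"
  shows "1 - t + measure \<mu> {2..} * t ^ 2 \<le> (\<integral>n. (1 - t) ^ n \<partial>\<mu>)"
proof -
  have ind: "integrable (measure_pmf \<mu>) (\<lambda>n. indicator {2..} n :: real)"
    by (intro measure_pmf.integrable_const_bound[of _ 1]) auto
  have "1 - t + measure \<mu> {2..} * t ^ 2 = (\<integral>n. 1 - real n * t + indicator {2..} n * t ^ 2 \<partial>\<mu>)"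
    using assms(1) ind by (simp add: has_bochner_integral_iff)
  also have "\<dots> \<le> (\<integral>n. (1 - t) ^ n \<partial>\<mu>)"
  proof (rule integral_mono)
    show "integrable (measure_pmf \<mu>) (\<lambda>n. (1 - t) ^ n)"
      using assms by (intro measure_pmf.integrable_const_bound[of _ 1]) (auto simp: power_le_one)
  qed (use assms ind in \<open>auto simp: has_bochner_integral_iff intro: Bernoulli_second_order\<close>)
  finally show ?thesis .
qed

text \<open>Without mass on \<open>{2..}\<close> the mean would be \<open>pmf \<mu> 1\<close>, which
  is less than 1.\<close>

lemma critical_branching_pos:
  assumes "has_bochner_integral (measure_pmf \<mu>) real 1" "pmf \<mu> 1 < 1"
  shows "0 < measure \<mu> {2..}"
proof (rule ccontr)
  assume "\<not> 0 < measure \<mu> {2..}"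
  then have "measure \<mu> {2..} = 0" using measure_nonneg[of \<mu> "{2..}"] by linarith
  then have "set_pmf \<mu> \<inter> {2..} = {}" by (simp add: measure_pmf_zero_iff)
  then have "AE n in \<mu>. real n = indicator {1} n"
    by (auto simp: AE_measure_pmf_iff indicator_def not_le disjoint_iff less_2_cases_iff)
  then have "(\<integral>n. real n \<partial>\<mu>) = (\<integral>n. indicator {1} n \<partial>\<mu>)"
    by (intro integral_cong_AE) auto
  also have "\<dots> = pmf \<mu> 1" by (simp add: measure_pmf_single)
  finally show False using assms by (simp add: has_bochner_integral_iff)
qed

section \<open>The upper bound\<close>

lemma real_vec_add: "real_vec (x + y) = real_vec x + real_vec y"
  by (simp add: real_vec_def vec_eq_iff)

lemma real_vec_minus: "real_vec (- x) = - real_vec x"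
  by (simp add: real_vec_def vec_eq_iff)

lemma real_vec_0 [simp]: "real_vec 0 = 0"
  by (simp add: real_vec_def vec_eq_iff)

text \<open>The integer vectors orthogonal to \<open>u\<close> form a subgroup; if it contains the
  support it is everything, including the unit vectors.\<close>

lemma orthogonal_to_generating_support:
  fixes \<theta> :: "(int ^ 'n) pmf"
  assumes "\<not> (\<exists>H. subgroup H vec_group \<and> H \<noteq> UNIV \<and> set_pmf \<theta> \<subseteq> H)"
    and "\<forall>y\<in>set_pmf \<theta>. u \<bullet> real_vec y = 0"
  shows "u = 0"
proof -
  let ?H = "{y. u \<bullet> real_vec y = 0}"
  have "subgroup ?H vec_group"
    by (simp add: subgroup_vec_group_iff real_vec_add real_vec_minus inner_add_right)
  with assms have "?H = UNIV" by blast
  then have "u \<bullet> real_vec (axis i 1) = 0" for i by blast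
  moreover have "real_vec (axis i 1) = axis i 1" for i :: 'n
    by (simp add: real_vec_def vec_eq_iff axis_def)
  ultimately show ?thesis by (simp add: inner_axis vec_eq_iff)
qed

text \<open>The condition \<open>C * \<psi> q0 \<le> measure \<mu> {2..}\<close> lets the quadratic
  gain from branching absorb the error of the one-step estimate.\<close>

lemma barrier_supersolution:
  fixes \<mu> :: "nat pmf" and \<theta> :: "(int ^ 'n) pmf"
  assumes critical: "has_bochner_integral (measure_pmf \<mu>) real 1"
    and A: "linear A"
    and q0: "6 \<le> q0" "C * \<psi> q0 \<le> measure \<mu> {2..}"
    and step: "\<And>x. q0 \<le> x \<bullet> A x \<Longrightarrow>
      (\<integral>y. barrier q0 ((x + real_vec y) \<bullet> A (x + real_vec y)) \<partial>\<theta>) \<le>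
        (\<psi> (x \<bullet> A x) + C * \<psi> (x \<bullet> A x) ^ 2) / \<psi> q0"
  shows "supersolution \<mu> \<theta> a (\<lambda>z. barrier q0 (real_vec (z - a) \<bullet> A (real_vec (z - a))))"
proof
  let ?w = "\<lambda>z. barrier q0 (real_vec (z - a) \<bullet> A (real_vec (z - a)))"
  show w01: "0 \<le> ?w z" "?w z \<le> 1" for z
    using q0 by (auto intro!: barrier_bounds)
  show "?w a = 1" using q0 by (simp add: barrier_def)
  fix z
  define x where "x = real_vec (z - a)"
  define q where "q = x \<bullet> A x"
  define t where "t = (\<integral>y. ?w (z + y) \<partial>\<theta>)"
  have int_w: "integrable (measure_pmf \<theta>) (\<lambda>y. ?w (z + y))"
    using w01 by (intro measure_pmf.integrable_const_bound[of _ 1]) auto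
  have "0 \<le> t" unfolding t_def using w01 by (intro integral_nonneg_AE) auto
  moreover have "t \<le> (\<integral>y. 1 \<partial>\<theta>)"
    unfolding t_def using w01 by (intro integral_mono int_w) auto
  ultimately have t: "0 \<le> t" "t \<le> 1" by simp_all
  have "1 - ?w z \<le> 1 - t + measure \<mu> {2..} * t ^ 2"
  proof (cases "t \<le> ?w z")
    case True
    then show ?thesis by (simp add: add_increasing2)
  next
    \<comment> \<open>Now \<open>?w z < t \<le> 1\<close>, so \<open>z\<close> lies where the
      barrier is given by \<open>\<psi>\<close> and the one-step estimate applies. Later
      \<open>?w z < t\<close> lets the gain be expressed by \<open>t\<close>.\<close>
    case False
    then have q: "q0 \<le> q" using t(2) by (auto simp: barrier_def q_def x_def split: if_splits)
    have pos: "0 < \<psi> q0" "0 < \<psi> q" using psi_deriv_signs(1) q0 q by auto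
    have w_eq: "?w z = \<psi> q / \<psi> q0" using q by (simp add: barrier_def q_def x_def)
    have "real_vec (z + y - a) = x + real_vec y" for y
      by (simp add: x_def flip: real_vec_add) (simp add: algebra_simps)
    then have "t \<le> (\<psi> q + C * \<psi> q ^ 2) / \<psi> q0"
      using step[of x] q by (simp add: t_def q_def)
    moreover have "C * \<psi> q ^ 2 / \<psi> q0 \<le> measure \<mu> {2..} * (\<psi> q / \<psi> q0) ^ 2"
    proof -
      have "C * \<psi> q ^ 2 / \<psi> q0 = C * \<psi> q0 * (\<psi> q / \<psi> q0) ^ 2"
        using pos by (simp add: power2_eq_square)
      also have "\<dots> \<le> measure \<mu> {2..} * (\<psi> q / \<psi> q0) ^ 2"
        using q0 by (intro mult_right_mono) auto
      finally show ?thesis .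
    qed
    moreover have "measure \<mu> {2..} * (\<psi> q / \<psi> q0) ^ 2 \<le> measure \<mu> {2..} * t ^ 2"
      using False w_eq pos by (intro mult_left_mono power_mono) auto
    ultimately show ?thesis unfolding w_eq add_divide_distrib by linarith
  qed
  also have "\<dots> \<le> (\<integral>n. (1 - t) ^ n \<partial>\<mu>)"
    by (rule offspring_gf_ge[OF critical t])
  finally show "1 - ?w z \<le> (\<integral>n. (1 - (\<integral>y. ?w (z + y) \<partial>\<theta>)) ^ n \<partial>\<mu>)"
    by (simp add: t_def)
qed

text \<open>From \<open>1 \<le> c * r\<close> follows \<open>r \<le> c * r ^ 2\<close>, so the
  logarithm of the form is at least \<open>ln r\<close>.\<close>

lemma psi_quadratic_le:
  assumes r: "1 < r" "1 \<le> c * r" and c: "0 < c" and q: "c * r ^ 2 \<le> q"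
  shows "\<psi> q \<le> (1 / c) * (1 / (r ^ 2 * ln r))"
proof -
  have "r \<le> c * r ^ 2" using mult_right_mono[OF r(2), of r] r by (simp add: power2_eq_square)
  then have "\<psi> q \<le> \<psi> (c * r ^ 2)" and "ln r \<le> ln (c * r ^ 2)"
    using r q by (auto intro!: psi_antimono)
  note this(1)
  also have "\<psi> (c * r ^ 2) \<le> 1 / (c * r ^ 2 * ln r)"
    unfolding \<psi>_def using \<open>ln r \<le> ln (c * r ^ 2)\<close> r c
    by (intro divide_left_mono mult_left_mono mult_pos_pos) auto
  finally show ?thesis by (simp add: mult.assoc)
qed

theorem theorem1p1:
  fixes \<mu> :: "nat pmf" and \<theta> :: "(int ^ 4) pmf"
  assumes critical: "has_bochner_integral (measure_pmf \<mu>) real 1"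
    and nondegenerate: "pmf \<mu> 1 < 1"
    and zero_mean: "has_bochner_integral (measure_pmf \<theta>) real_vec 0"
    and fifth_moment: "integrable (measure_pmf \<theta>) (\<lambda>x. norm (real_vec x) ^ 5)"
    and not_on_strict_subgroup:
      "\<not> (\<exists>H. subgroup H vec_group \<and> H \<noteq> UNIV \<and> set_pmf \<theta> \<subseteq> H)"
  shows "\<exists>C > 0. \<exists>R. \<forall>a :: int ^ 4. norm (real_vec a) \<ge> R \<longrightarrow>
    \<P>(\<omega> in brw \<mu> \<theta>. visits \<omega> a)
      \<le> C * (1 / (norm (real_vec a) ^ 2 * ln (norm (real_vec a))))"
proof -
  have second_moment: "integrable (measure_pmf \<theta>) (\<lambda>x. norm (real_vec x) ^ 2)"
    by (rule integrable_norm_power_mono[OF fifth_moment]) simp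
  obtain A :: "real ^ 4 \<Rightarrow> real ^ 4" where
    A: "linear A" "\<And>x y. A x \<bullet> y = x \<bullet> A y" "\<And>x. x \<noteq> 0 \<Longrightarrow> 0 < x \<bullet> A x" and
    cov: "\<And>x. (\<integral>y. (A x \<bullet> real_vec y) ^ 2 \<partial>\<theta>) = x \<bullet> A x"
      "(\<integral>y. real_vec y \<bullet> A (real_vec y) \<partial>\<theta>) = DIM(real ^ 4)"
    using inverse_covariance[OF second_moment orthogonal_to_generating_support[OF not_on_strict_subgroup]]
    by blast
  obtain c where c: "0 < c" "\<And>x. c * norm x ^ 2 \<le> x \<bullet> A x"
    using quadratic_form_lower_bound[OF A(1,3)] by blast
  obtain K where K: "\<And>q0 x. 6 \<le> q0 \<Longrightarrow> q0 \<le> x \<bullet> A x \<Longrightarrow>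
      (\<integral>y. barrier q0 ((x + real_vec y) \<bullet> A (x + real_vec y)) \<partial>\<theta>) \<le>
        (\<psi> (x \<bullet> A x) + K * \<psi> (x \<bullet> A x) ^ 2) / \<psi> q0"
    using expectation_barrier_le[OF zero_mean fifth_moment A(1,2) c cov(1)] cov(2) by auto
  define b where "b = measure \<mu> {2..}"
  have b: "0 < b" unfolding b_def by (rule critical_branching_pos[OF critical nondegenerate])
  \<comment> \<open>The value 6 serves the Taylor estimates; \<open>K / b\<close> yields
    \<open>K * \<psi> q0 \<le> b\<close>, because \<open>ln q0 \<ge> 1\<close>.\<close>
  define q0 where "q0 = max 6 (K / b)"
  have q0: "6 \<le> q0" "K / b \<le> q0" by (simp_all add: q0_def)
  have psi_q0: "0 < \<psi> q0" using psi_deriv_signs(1)[of q0] q0 by simp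
  have "K * \<psi> q0 \<le> b"
  proof -
    have "q0 * 1 \<le> q0 * ln q0" using one_le_ln[of q0] q0 by (intro mult_left_mono) auto
    with q0 have "K / b \<le> q0 * ln q0" by linarith
    moreover have "0 < q0 * ln q0" using q0 by simp
    ultimately show ?thesis using b by (simp add: \<psi>_def divide_simps mult.commute)
  qed
  then have super: "supersolution \<mu> \<theta> a (\<lambda>z. barrier q0 (real_vec (z - a) \<bullet> A (real_vec (z - a))))" for a
    using K[OF q0(1)] by (intro barrier_supersolution[OF critical A(1) q0(1)]) (auto simp: b_def)
  have "\<P>(\<omega> in brw \<mu> \<theta>. visits \<omega> a) \<le>
      1 / (c * \<psi> q0) * (1 / (norm (real_vec a) ^ 2 * ln (norm (real_vec a))))"
    if R: "max 2 (q0 / c) \<le> norm (real_vec a)" for a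
  proof -
    define r where "r = norm (real_vec a)"
    define q where "q = real_vec a \<bullet> A (real_vec a)"
    \<comment> \<open>The radius makes \<open>c * r \<ge> q0\<close>, hence
      \<open>q \<ge> q0\<close>: the starting point lies outside the region where the barrier equals
      1 by definition.\<close>
    have r: "2 \<le> r" "q0 \<le> c * r" using R c by (auto simp: r_def pos_divide_le_eq mult.commute)
    have q: "c * r ^ 2 \<le> q" using c(2)[of "real_vec a"] by (simp add: r_def q_def)
    have "q0 * 1 \<le> (c * r) * r" using r q0 by (intro mult_mono) auto
    with q have "q0 \<le> q" by (simp add: power2_eq_square)
    have "\<P>(\<omega> in brw \<mu> \<theta>. visits \<omega> a) \<le> barrier q0 q"
      \<comment> \<open>At the origin the barrier is evaluated at \<open>- a\<close>, where the
        quadratic form has the same value as at \<open>a\<close>.\<close>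
      using supersolution.prob_visits_le[OF super[of a]]
      by (simp add: q_def real_vec_minus linear_neg[OF A(1)])
    also have "\<dots> = \<psi> q / \<psi> q0" using \<open>q0 \<le> q\<close> by (simp add: barrier_def)
    also have "\<dots> \<le> (1 / c) * (1 / (r ^ 2 * ln r)) / \<psi> q0"
      using psi_q0 r q0 q c by (intro divide_right_mono psi_quadratic_le) auto
    finally show ?thesis
      by (simp add: r_def mult_ac)
  qed
  moreover have "0 < 1 / (c * \<psi> q0)" using c psi_q0 by simp
  ultimately show ?thesis by blast
qed

end
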